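(* Let $p>1$ and let $G=(\mathbb{V},\mathbb{E})$ be a connected, undirected, locally finite quasi-transitive graph. Suppose $\Gamma\le\mathrm{Aut}(G)$ and the action of $\Gamma$ on $G$ has finitely many orbits. Let $V:\mathbb{V}\to\mathbb{R}$ satisfy $\inf_{x\in\mathbb{V}}V(x)>-1$, and fix $x_0\in\mathbb{V}$. Assume that one of the following holds: (a) $V$ is $\Gamma$-invariant; (b) there exists a $\Gamma$-invariant function $V_p:\mathbb{V}\to\mathbb{R}$ such that $V(x)\le V_p(x)$ for all $x\in\mathbb{V}$ and $|V(x)-V_p(x)|\to0$ as $d(x,x_0)\to+\infty$; (c) $\sup_{x\in\mathbb{V}}V(x)=V_\infty<\infty$ with $V_\infty=\lim_{d(x,x_0)\to\infty}V(x)$. Then the equation $$-\Delta_pu(x)+V(x)|u|^{p-2}u=|u|^{p-2}u\log|u|^p,\quad x\in\mathbb{V},$$ has a ground state solution $u$. Moreover, $u(x)>0$ for all $x\in\mathbb{V}$ or $u(x)<0$ for all $x\in\mathbb{V}$.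
   Context: In $V_p$ the subscript is a label (for "periodic"), unrelated to the exponent $p$. $\mathrm{Aut}(G)$ is the group of automorphisms of $G$; $G$ is quasi-transitive if the action of $\mathrm{Aut}(G)$ on $G$ has finitely many orbits. A function $g$ on $\mathbb{V}$ is $\Gamma$-invariant if $g(\gamma x)=g(x)$ for all $\gamma\in\Gamma$, $x\in\mathbb{V}$. $x\sim y$ means $xy\in\mathbb{E}$; $d$ is the graph distance. All functions are real valued, $\mu$ is the counting measure, $\int_{\mathbb{V}}f\,d\mu=\sum_xf(x)$. $\Delta_pu(x)=\sum_{y\sim x}|u(y)-u(x)|^{p-2}(u(y)-u(x))$ (with $|t|^{p-2}t=0$ at $t=0$), $|\nabla u(x)|_p=\left(\frac12\sum_{y\sim x}|u(y)-u(x)|^p\right)^{1/p}$. $W^{1,p}(\mathbb{V})$ is the completion of the finitely supported functions under $\left(\int_{\mathbb{V}}(|\nabla u|_p^p+|u|^p)d\mu\right)^{1/p}$; the working space is $X=W^{1,p}(\mathbb{V})$ with the norm $\left(\int_{\mathbb{V}}(|\nabla u|_p^p+(V+1)|u|^p)d\mu\right)^{1/p}$. The energy $J:X\to(-\infty,+\infty]$ is $$J(u)=\frac1p\int_{\mathbb{V}}\left(|\nabla u|_p^p+(V(x)+1)|u|^p\right)d\mu-\frac1p\int_{\mathbb{V}}|u|^p\log|u|^p\,d\mu$$ with $0\log0=0$; $D(J)=\{u\in X:J(u)<+\infty\}$. The Nehari manifold is $$\mathcal{N}=\left\{u\in D(J)\setminus\{0\}:\int_{\mathbb{V}}(|\nabla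 u|_p^p+V|u|^p)\,d\mu=\int_{\mathbb{V}}|u|^p\log|u|^p\,d\mu\right\}.$$ A solution is $u\in D(J)$ satisfying the equation at every vertex; a ground state solution is a nontrivial solution $u$ with $J(u)=\inf_{\mathcal{N}}J$. *)

theory Defs
  imports "HOL-Analysis.Analysis" "HOL-Algebra.Group_Action"
begin

section \<open>Graphs and their automorphisms\<close>

text \<open>
  A graph is given by its adjacency relation \<open>E\<close> on the type \<open>'v\<close> of all vertices; it is undirected
  iff \<open>E\<close> is symmetric (\<^term>\<open>sym E\<close>), and the neighbours of \<open>x\<close> are \<open>E `` {x}\<close>. Irreflexivity is
  never imposed, so simple graphs are covered; a loop contributes only a zero term to
  the difference operators below.
\<close>

definition graph_connected :: "('v \<times> 'v) set \<Rightarrow> bool" where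
  "graph_connected E \<longleftrightarrow> (\<forall>x y. (x, y) \<in> E\<^sup>*)"

definition locally_finite_graph :: "('v \<times> 'v) set \<Rightarrow> bool" where
  "locally_finite_graph E \<longleftrightarrow> (\<forall>x. finite (E `` {x}))"

definition graph_dist :: "('v \<times> 'v) set \<Rightarrow> 'v \<Rightarrow> 'v \<Rightarrow> nat" where
  "graph_dist E x y = (LEAST n. (x, y) \<in> E ^^ n)"

definition graph_Aut :: "('v \<times> 'v) set \<Rightarrow> ('v \<Rightarrow> 'v) monoid" where
  "graph_Aut E = BijGroup UNIV
     \<lparr>carrier := {\<gamma> \<in> Bij UNIV. \<forall>x y. (\<gamma> x, \<gamma> y) \<in> E \<longleftrightarrow> (x, y) \<in> E}\<rparr>"

text \<open>
  The action of a set \<open>\<Gamma>\<close> of automorphisms on the vertices is the tautological one,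
  \<open>\<gamma> \<cdot> x = \<gamma> x\<close>, hence the \<^term>\<open>id\<close>.
\<close>

definition finitely_many_orbits :: "('v \<times> 'v) set \<Rightarrow> ('v \<Rightarrow> 'v) set \<Rightarrow> bool" where
  "finitely_many_orbits E \<Gamma> \<longleftrightarrow> finite (orbits (graph_Aut E\<lparr>carrier := \<Gamma>\<rparr>) UNIV id)"

definition quasi_transitive :: "('v \<times> 'v) set \<Rightarrow> bool" where
  "quasi_transitive E \<longleftrightarrow> finitely_many_orbits E (carrier (graph_Aut E))"

definition invariant_under :: "('v \<Rightarrow> 'v) set \<Rightarrow> ('v \<Rightarrow> real) \<Rightarrow> bool" where
  "invariant_under \<Gamma> g \<longleftrightarrow> (\<forall>\<gamma>\<in>\<Gamma>. \<forall>x. g (\<gamma> x) = g x)"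

text \<open>The filter \<open>d(x, x\<^sub>0) \<rightarrow> \<infinity>\<close> on the vertices; it is \<^term>\<open>bot\<close> when the graph is finite.\<close>

definition at_graph_infinity :: "('v \<times> 'v) set \<Rightarrow> 'v \<Rightarrow> 'v filter" where
  "at_graph_infinity E x0 = filtercomap (\<lambda>x. graph_dist E x x0) at_top"

lemma group_graph_Aut: "group (graph_Aut E)"
proof -
  let ?A = "{\<gamma> \<in> Bij (UNIV :: 'a set). \<forall>x y. (\<gamma> x, \<gamma> y) \<in> E \<longleftrightarrow> (x, y) \<in> E}"
  have "subgroup ?A (BijGroup UNIV)"
  proof (rule group.subgroupI[OF group_BijGroup])
    show "?A \<subseteq> carrier (BijGroup UNIV)" by (auto simp: BijGroup_def)
    show "?A \<noteq> {}" using id_Bij[of "UNIV :: 'a set"] by auto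
  next
    fix a assume a: "a \<in> ?A"
    then have b: "bij a" by (auto simp: Bij_def)
    have "(inv_into UNIV a) \<in> ?A"
      using a b by (auto simp: Bij_def bij_imp_bij_inv) (metis bij_inv_eq_iff)+
    then show "inv\<^bsub>BijGroup UNIV\<^esub> a \<in> ?A"
      using a by (simp add: inv_BijGroup restrict_def)
  next
    fix a b assume "a \<in> ?A" "b \<in> ?A"
    then show "a \<otimes>\<^bsub>BijGroup UNIV\<^esub> b \<in> ?A"
      using compose_Bij[of a UNIV b] by (auto simp: BijGroup_def compose_def)
  qed
  then show ?thesis
    unfolding graph_Aut_def by (rule subgroup.subgroup_is_group) (rule group_BijGroup)
qed


section \<open>The energy functional\<close>

definition p_Laplacian :: "real \<Rightarrow> ('v \<times> 'v) set \<Rightarrow> ('v \<Rightarrow> real) \<Rightarrow> 'v \<Rightarrow> real" where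
  "p_Laplacian p E u x = (\<Sum>y\<in>E `` {x}. \<bar>u y - u x\<bar> powr (p - 2) * (u y - u x))"

definition grad_norm :: "real \<Rightarrow> ('v \<times> 'v) set \<Rightarrow> ('v \<Rightarrow> real) \<Rightarrow> 'v \<Rightarrow> real" where
  "grad_norm p E u x = (1 / 2 * (\<Sum>y\<in>E `` {x}. \<bar>u y - u x\<bar> powr p)) powr (1 / p)"

definition W1p_norm :: "real \<Rightarrow> ('v \<times> 'v) set \<Rightarrow> ('v \<Rightarrow> real) \<Rightarrow> real" where
  "W1p_norm p E u =
     (\<integral>x. grad_norm p E u x powr p + \<bar>u x\<bar> powr p \<partial>count_space UNIV) powr (1 / p)"

text \<open>
  The completion of the finitely supported functions, realised as a space of functions: an element
  is the pointwise limit of a Cauchy sequence of finitely supported functions. Since the norm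
  dominates the \<open>\<ell>\<^sup>p\<close> norm, every Cauchy sequence converges pointwise, and two Cauchy sequences
  have the same pointwise limit iff the norm of their difference tends to \<open>0\<close>. On a locally finite
  graph \<^term>\<open>W1p_norm\<close> is here only applied to functions whose integrand has finite support.
\<close>

definition W1p :: "real \<Rightarrow> ('v \<times> 'v) set \<Rightarrow> ('v \<Rightarrow> real) set" where
  "W1p p E = {u. \<exists>\<phi> :: nat \<Rightarrow> 'v \<Rightarrow> real.
     (\<forall>n. finite {x. \<phi> n x \<noteq> 0}) \<and>
     (\<forall>\<epsilon>>0. \<exists>N. \<forall>m\<ge>N. \<forall>n\<ge>N. W1p_norm p E (\<lambda>x. \<phi> m x - \<phi> n x) < \<epsilon>) \<and>
     (\<forall>x. (\<lambda>n. \<phi> n x) \<longlonglongrightarrow> u x)}"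

text \<open>
  The Lebesgue integral with values in the extended reals, \<open>\<integral> f\<^sup>+ - \<integral> f\<^sup>-\<close>. (The Bochner integral of
  a non-integrable function is \<open>0\<close>, which would be wrong where the energy is infinite.) For
  \<open>u \<in> W1p p E\<close> and \<open>V\<close> bounded below, no term below is of the form \<open>\<infinity> - \<infinity>\<close>: the integral of
  \<open>V |u|\<^sup>p\<close> has a finite negative part, and \<open>|u|\<^sup>p log |u|\<^sup>p\<close> is positive at only finitely many
  vertices.
\<close>

definition ext_integral :: "'a measure \<Rightarrow> ('a \<Rightarrow> real) \<Rightarrow> ereal" where
  "ext_integral M f =
     enn2ereal (\<integral>\<^sup>+x. ennreal (f x) \<partial>M) - enn2ereal (\<integral>\<^sup>+x. ennreal (- f x) \<partial>M)"

lemma ext_integral_eq_integral: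
  assumes "integrable M f"
  shows "ext_integral M f = ereal (\<integral>x. f x \<partial>M)"
proof -
  obtain r q where rq: "0 \<le> r" "0 \<le> q"
    "(\<integral>\<^sup>+x. ennreal (f x) \<partial>M) = ennreal r" "(\<integral>\<^sup>+x. ennreal (- f x) \<partial>M) = ennreal q"
    "integral\<^sup>L M f = r - q"
    using integrableE[OF assms] by metis
  then show ?thesis by (simp add: ext_integral_def enn2ereal_ennreal)
qed

definition energy :: "real \<Rightarrow> ('v \<times> 'v) set \<Rightarrow> ('v \<Rightarrow> real) \<Rightarrow> ('v \<Rightarrow> real) \<Rightarrow> ereal" where
  "energy p E V u =
     ereal (1 / p) * ext_integral (count_space UNIV)
       (\<lambda>x. grad_norm p E u x powr p + (V x + 1) * \<bar>u x\<bar> powr p)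
   - ereal (1 / p) * ext_integral (count_space UNIV) (\<lambda>x. \<bar>u x\<bar> powr p * ln (\<bar>u x\<bar> powr p))"

definition energy_domain :: "real \<Rightarrow> ('v \<times> 'v) set \<Rightarrow> ('v \<Rightarrow> real) \<Rightarrow> ('v \<Rightarrow> real) set" where
  "energy_domain p E V = {u \<in> W1p p E. energy p E V u < \<infinity>}"

definition nehari :: "real \<Rightarrow> ('v \<times> 'v) set \<Rightarrow> ('v \<Rightarrow> real) \<Rightarrow> ('v \<Rightarrow> real) set" where
  "nehari p E V = {u \<in> energy_domain p E V - {\<lambda>x. 0}.
     ext_integral (count_space UNIV) (\<lambda>x. grad_norm p E u x powr p + V x * \<bar>u x\<bar> powr p)
   = ext_integral (count_space UNIV) (\<lambda>x. \<bar>u x\<bar> powr p * ln (\<bar>u x\<bar> powr p))}"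

definition is_solution :: "real \<Rightarrow> ('v \<times> 'v) set \<Rightarrow> ('v \<Rightarrow> real) \<Rightarrow> ('v \<Rightarrow> real) \<Rightarrow> bool" where
  "is_solution p E V u \<longleftrightarrow> u \<in> energy_domain p E V \<and>
     (\<forall>x. - p_Laplacian p E u x + V x * \<bar>u x\<bar> powr (p - 2) * u x
          = \<bar>u x\<bar> powr (p - 2) * u x * ln (\<bar>u x\<bar> powr p))"

definition is_ground_state :: "real \<Rightarrow> ('v \<times> 'v) set \<Rightarrow> ('v \<Rightarrow> real) \<Rightarrow> ('v \<Rightarrow> real) \<Rightarrow> bool" where
  "is_ground_state p E V u \<longleftrightarrow> is_solution p E V u \<and> u \<noteq> (\<lambda>x. 0) \<and>
     energy p E V u = (INF v\<in>nehari p E V. energy p E V v)"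

end

theory Submission
  imports Defs "HOL-Real_Asymp.Real_Asymp"
begin

text \<open>
  Write \<open>M u\<close> for the mass \<open>\<integral> |u|\<^sup>p\<close> and \<open>N u\<close> for \<open>\<integral> (|\<nabla>u|\<^sup>p + V |u|\<^sup>p) - \<integral> |u|\<^sup>p log |u|\<^sup>p\<close>. Then
  \<open>J = (N + M) / p\<close>, the Nehari manifold consists of the nonzero zeros of \<open>N\<close>, and the logarithm gives the scaling law
  \<open>N (c u) = c\<^sup>p N u - c\<^sup>p ln (c\<^sup>p) M u\<close>. Hence every admissible ray meets the Nehari manifold in exactly one
  point, with energy \<open>exp (N v) / p\<close> where \<open>v\<close> is the point of mass \<open>1\<close> on the ray. Ground states
  are thus the rescaled minimisers of \<open>N\<close> on the sphere \<open>M = 1\<close>, a problem of logarithmic Sobolev type.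
  Let \<open>m\<close> be the infimum there; by scaling \<open>N u \<ge> m M u - M u ln (M u)\<close> for all admissible \<open>u\<close>
  (\<open>nehari_functional_ge\<close>).

  A minimiser exists for the following reasons. On the sphere the entropy \<open>- \<integral> |u|\<^sup>p log |u|\<^sup>p\<close> is nonnegative
  and bounded along a minimising sequence, so the sequence cannot vanish: some vertex carries a fixed
  amount of mass (\<open>entropy_concentration\<close>). As there are finitely many orbits, automorphisms
  move that vertex to a fixed one, and a pointwise limit of the translates is nonzero. Mass cannot split
  off either (\<open>minimizing_filter_compact\<close>): cutting along a finite set preserves mass, potential and entropy
  and changes the gradient term only on the boundary of the set, and two pieces of masses \<open>a\<close> and
  \<open>1 - a\<close> cost \<open>m - a ln a - (1 - a) ln (1 - a) > m\<close>. So the limit has mass \<open>1\<close>, and lower semicontinuity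
  bounds its functional by \<open>m\<close>.

  Each of the three alternatives for the potential says that \<open>V\<close> lies below an invariant potential \<open>Vp\<close> to which it is
  asymptotic. If the translations escape to infinity, the limit minimises for \<open>Vp\<close>, and a fortiori
  for \<open>V \<le> Vp\<close> (\<open>minimizer_exists\<close>). The equation follows by varying the minimiser at one
  vertex at a time (\<open>euler_lagrange\<close>), and positivity from the maximum principle, since \<open>N\<close> does not increase
  when \<open>u\<close> is replaced by \<open>|u|\<close> (\<open>strong_maximum_principle\<close>).

  On a graph of bounded degree \<open>W\<^sup>1\<^sup>,\<^sup>p\<close> is \<open>\<ell>\<^sup>p\<close>, so that for bounded \<open>V\<close> the domain of \<open>J\<close> consists of the
  functions with summable \<open>|u|\<^sup>p\<close> and summable entropy (\<open>energy_domain_iff\<close>), and all integrals become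
  unconditional sums.
\<close>

section \<open>Calculus of powers and entropies\<close>

lemma has_real_derivative_abs_powr:
  fixes p t :: real
  assumes "p > 1"
  shows "((\<lambda>t. \<bar>t\<bar> powr p) has_real_derivative p * (\<bar>t\<bar> powr (p - 2) * t)) (at t)"
proof -
  consider "t > 0" | "t < 0" | "t = 0" by linarith
  then show ?thesis
  proof cases
    case 1
    have "((\<lambda>t. t powr p) has_real_derivative p * t powr (p - 1)) (at t)"
      using 1 by (rule has_real_derivative_powr)
    moreover have "t powr (p - 1) = t powr (p - 2) * t"
      using 1 powr_mult_base[of t "p - 2"] by (simp add: mult.commute)
    ultimately have "((\<lambda>t. t powr p) has_real_derivative p * (\<bar>t\<bar> powr (p - 2) * t)) (at t)"
      using 1 by simp
    then show ?thesis
      by (rule has_field_derivative_transform_within_open[of _ _ _ "{0<..}"]) (use 1 in auto)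
  next
    case 2
    have "((\<lambda>t. (- t) powr p) has_real_derivative - (p * (- t) powr (p - 1))) (at t)"
      using 2 by (auto intro!: derivative_eq_intros has_real_derivative_powr)
    moreover have "(- t) powr (p - 1) = - ((- t) powr (p - 2) * t)"
      using 2 powr_mult_base[of "-t" "p - 2"] by (simp add: mult.commute)
    ultimately have "((\<lambda>t. (- t) powr p) has_real_derivative p * (\<bar>t\<bar> powr (p - 2) * t)) (at t)"
      using 2 by simp
    then show ?thesis
      by (rule has_field_derivative_transform_within_open[of _ _ _ "{..<0}"]) (use 2 in auto)
  next
    case 3
    have "((\<lambda>h::real. \<bar>h\<bar> powr (p - 1)) \<longlongrightarrow> 0) (at 0)"
      using assms by real_asymp
    moreover have "norm (\<bar>h\<bar> powr p / h) = \<bar>h\<bar> powr (p - 1)" if "h \<noteq> 0" for h :: real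
      using that by (simp add: powr_diff)
    ultimately have "((\<lambda>h::real. \<bar>h\<bar> powr p / h) \<longlongrightarrow> 0) (at 0)"
      by (intro tendsto_norm_zero_cancel[where f = "\<lambda>h::real. \<bar>h\<bar> powr p / h"])
        (auto elim!: Lim_transform_eventually simp: eventually_at_filter)
    with 3 show ?thesis by (simp add: DERIV_def)
  qed
qed

text \<open>
  At \<open>t = 0\<close> the factor \<open>w ln w\<close> is not differentiable, but \<open>w = |t|\<^sup>p\<close> is flat enough there: since
  \<open>p > 1\<close>, the difference quotient is \<open>|t|\<^sup>p\<^sup>-\<^sup>1 \<cdot> p ln |t|\<close> up to sign and tends to \<open>0\<close>.
\<close>
lemma has_real_derivative_abs_powr_ln:
  fixes p t :: real
  assumes "p > 1"
  shows "((\<lambda>t. \<bar>t\<bar> powr p * ln (\<bar>t\<bar> powr p)) has_real_derivative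
           p * (\<bar>t\<bar> powr (p - 2) * t) * (ln (\<bar>t\<bar> powr p) + 1)) (at t)"
proof (cases "t = 0")
  case False
  have "((\<lambda>w::real. w * ln w) has_real_derivative ln (\<bar>t\<bar> powr p) + 1) (at (\<bar>t\<bar> powr p))"
    using False by (auto intro!: derivative_eq_intros simp: field_simps)
  from DERIV_chain2[OF this has_real_derivative_abs_powr[OF assms]] show ?thesis
    by (simp add: mult_ac)
next
  case True
  have "((\<lambda>h::real. \<bar>h\<bar> powr (p - 1) * (p * ln \<bar>h\<bar>)) \<longlongrightarrow> 0) (at 0)"
    using assms by real_asymp
  then have "((\<lambda>h::real. norm (\<bar>h\<bar> powr (p - 1) * (p * ln \<bar>h\<bar>))) \<longlongrightarrow> 0) (at 0)"
    by (rule tendsto_norm_zero)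
  moreover have "norm (\<bar>h\<bar> powr p * ln (\<bar>h\<bar> powr p) / h) = norm (\<bar>h\<bar> powr (p - 1) * (p * ln \<bar>h\<bar>))"
    if "h \<noteq> 0" for h :: real
    using that by (simp add: powr_diff ln_powr abs_mult)
  ultimately have "((\<lambda>h::real. \<bar>h\<bar> powr p * ln (\<bar>h\<bar> powr p) / h) \<longlongrightarrow> 0) (at 0)"
    by (intro tendsto_norm_zero_cancel[where f = "\<lambda>h::real. \<bar>h\<bar> powr p * ln (\<bar>h\<bar> powr p) / h"])
      (auto elim!: Lim_transform_eventually simp: eventually_at_filter)
  with True show ?thesis by (simp add: DERIV_def)
qed

lemma abs_diff_powr_le:
  fixes a b p :: real
  assumes "p \<ge> 0"
  shows "\<bar>a - b\<bar> powr p \<le> 2 powr p * (\<bar>a\<bar> powr p + \<bar>b\<bar> powr p)"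
proof -
  have "\<bar>a - b\<bar> powr p \<le> (2 * max \<bar>a\<bar> \<bar>b\<bar>) powr p"
    using assms by (intro powr_mono2) auto
  also have "\<dots> = 2 powr p * max \<bar>a\<bar> \<bar>b\<bar> powr p"
    by (simp add: powr_mult)
  also have "\<dots> \<le> 2 powr p * (\<bar>a\<bar> powr p + \<bar>b\<bar> powr p)"
    by (auto simp: max_def)
  finally show ?thesis .
qed

section \<open>Convergence along finer filters\<close>

text \<open>
  Tychonoff's theorem for the cube \<open>[0,1]\<^sup>V\<close>. A finer filter takes the place of a subsequence: a cluster
  point of the image filter always exists, whereas extracting a pointwise convergent subsequence
  would require a diagonal argument.
\<close>
lemma pointwise_convergent_finer_filter:
  fixes v :: "'n \<Rightarrow> 'v \<Rightarrow> real"
  assumes F: "F \<noteq> bot" and v: "\<And>n x. v n x \<in> {0..1}"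
  obtains G l where "G \<le> F" "G \<noteq> bot" "\<And>x. ((\<lambda>n. v n x) \<longlongrightarrow> l x) G"
proof -
  have "compactin (product_topology (\<lambda>_. euclidean) UNIV) (PiE UNIV (\<lambda>_::'v. {0..1::real}))"
    by (subst compactin_PiE) auto
  then have "compact (PiE UNIV (\<lambda>_::'v. {0..1::real}))"
    by (simp add: euclidean_product_topology)
  moreover have "eventually (\<lambda>w. w \<in> PiE UNIV (\<lambda>_::'v. {0..1::real})) (filtermap v F)"
    using v by (auto simp: eventually_filtermap intro!: always_eventually)
  moreover have "filtermap v F \<noteq> bot"
    using F by (simp add: filtermap_bot_iff)
  ultimately obtain l where l: "inf (nhds l) (filtermap v F) \<noteq> bot"
    unfolding compact_filter by blast
  define G where "G = inf F (filtercomap v (nhds l))"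
  have "G \<noteq> bot"
  proof
    assume "G = bot"
    then have "eventually (\<lambda>_. False) G" by simp
    then obtain P Q where PQ: "eventually P F" "eventually Q (filtercomap v (nhds l))"
      "\<And>n. P n \<and> Q n \<Longrightarrow> False"
      unfolding G_def eventually_inf by auto
    then obtain R where R: "eventually R (nhds l)" "\<And>n. R (v n) \<Longrightarrow> Q n"
      unfolding eventually_filtercomap by auto
    have "eventually (\<lambda>w. \<not> R w) (filtermap v F)"
      unfolding eventually_filtermap using PQ(1) by (rule eventually_mono) (use PQ(3) R(2) in blast)
    with R(1) have "eventually (\<lambda>_. False) (inf (nhds l) (filtermap v F))"
      unfolding eventually_inf by blast
    with l show False by (simp add: trivial_limit_def)
  qed
  moreover have "((\<lambda>n. v n x) \<longlongrightarrow> l x) G" for x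
  proof -
    have "(v \<longlongrightarrow> l) G"
      unfolding filterlim_iff_le_filtercomap G_def by simp
    from continuous_on_tendsto_compose[OF continuous_on_product_coordinates[of x] this]
    show ?thesis by simp
  qed
  moreover have "G \<le> F" by (simp add: G_def)
  ultimately show thesis using that by blast
qed

text \<open>
  The pigeonhole principle; again a finer filter stands for a subsequence.
\<close>
lemma constant_on_finer_filter:
  assumes "\<exists>\<^sub>F n in F. f n \<in> A" "finite A"
  obtains a G where "a \<in> A" "G \<le> F" "G \<noteq> bot" "eventually (\<lambda>n. f n = a) G"
proof -
  have "\<exists>a\<in>A. \<exists>\<^sub>F n in F. f n = a"
  proof (rule ccontr)
    assume "\<not> ?thesis"
    then have "\<forall>a\<in>A. eventually (\<lambda>n. f n \<noteq> a) F" by (simp add: frequently_def)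
    then have "eventually (\<lambda>n. \<forall>a\<in>A. f n \<noteq> a) F"
      using assms(2) by (simp add: eventually_ball_finite)
    with assms(1) show False by (auto simp: frequently_def elim!: notE eventually_mono)
  qed
  then obtain a where a: "a \<in> A" "\<exists>\<^sub>F n in F. f n = a" by blast
  let ?G = "inf F (principal {n. f n = a})"
  have "?G \<noteq> bot"
    using a(2) by (auto simp: trivial_limit_def eventually_inf_principal frequently_def)
  moreover have "eventually (\<lambda>n. f n = a) ?G" by (simp add: eventually_inf_principal)
  ultimately show thesis using that a(1) by (metis inf_le1)
qed

section \<open>Unconditional sums over the vertices\<close>

lemma nonneg_infsum_le:
  fixes f :: "'a \<Rightarrow> real"
  assumes "\<And>x. f x \<ge> 0" "\<And>K. finite K \<Longrightarrow> sum f K \<le> C"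
  shows "f summable_on UNIV" "infsum f UNIV \<le> C"
proof -
  show s: "f summable_on UNIV"
    using assms by (intro nonneg_bdd_above_summable_on bdd_aboveI2[where M = C]) auto
  show "infsum f UNIV \<le> C"
    using s assms(2) by (rule infsum_le_finite_sums) 
qed

lemma sum_le_infsum:
  fixes f :: "'a \<Rightarrow> real"
  assumes "f summable_on UNIV" "\<And>x. f x \<ge> 0" "finite K"
  shows "sum f K \<le> infsum f UNIV"
  using assms by (intro finite_sum_le_infsum) auto

lemma summable_on_comparison_real:
  fixes f g :: "'a \<Rightarrow> real"
  assumes "g summable_on UNIV" "\<And>x. \<bar>f x\<bar> \<le> g x"
  shows "f summable_on UNIV"
  using Infinite_Sum.abs_summable_on_comparison_test'[of g UNIV f] summable_on_iff_abs_summable_on_real[of f UNIV] assms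
  by simp

lemma summable_on_if_real:
  fixes f :: "'a \<Rightarrow> real"
  assumes "f summable_on UNIV"
  shows "(\<lambda>x. if x \<in> A then f x else 0) summable_on UNIV"
proof -
  have "(\<lambda>x. \<bar>f x\<bar>) summable_on UNIV"
    using summable_on_iff_abs_summable_on_real[of f UNIV] assms by simp
  then show ?thesis by (rule summable_on_comparison_real) auto
qed

lemma infsum_diff_real:
  fixes f g :: "'a \<Rightarrow> real"
  assumes "f summable_on UNIV" "g summable_on UNIV"
  shows "(\<lambda>x. f x - g x) summable_on UNIV" "(\<Sum>\<^sub>\<infinity>x. f x - g x) = infsum f UNIV - infsum g UNIV"
proof -
  have g: "(\<lambda>x. - g x) summable_on UNIV" using assms(2) by (simp add: summable_on_uminus)
  show "(\<lambda>x. f x - g x) summable_on UNIV" using summable_on_add[OF assms(1) g] by simp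
  show "(\<Sum>\<^sub>\<infinity>x. f x - g x) = infsum f UNIV - infsum g UNIV"
    using infsum_add[OF assms(1) g] by (simp add: infsum_uminus)
qed

text \<open>
  The Cauchy criterion in the form used throughout: outside a finite set, no finite partial sum
  reaches \<open>e\<close>.
\<close>
lemma summable_tail:
  fixes f :: "'a \<Rightarrow> real"
  assumes "f summable_on UNIV" "\<And>x. f x \<ge> 0" "e > 0"
  obtains S where "finite S" "\<And>K. finite K \<Longrightarrow> K \<inter> S = {} \<Longrightarrow> sum f K < e"
proof -
  have "(sum f \<longlongrightarrow> infsum f UNIV) (finite_subsets_at_top UNIV)"
    using has_sum_infsum[OF assms(1)] unfolding has_sum_def .
  then have "eventually (\<lambda>S. sum f S > infsum f UNIV - e) (finite_subsets_at_top UNIV)"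
    using assms(3) by (intro order_tendstoD) auto
  then obtain S where S: "finite S" "sum f S > infsum f UNIV - e"
    unfolding eventually_finite_subsets_at_top by blast
  have "sum f K < e" if "finite K" "K \<inter> S = {}" for K
  proof -
    have "sum f K + sum f S = sum f (K \<union> S)"
      using that S by (subst sum.union_disjoint) auto
    also have "\<dots> \<le> infsum f UNIV"
      using that S assms by (intro sum_le_infsum) auto
    finally show ?thesis using S by simp
  qed
  with S show thesis using that by blast
qed

lemma summable_on_finite_change:
  fixes f g :: "'a \<Rightarrow> real"
  assumes f: "f summable_on UNIV" and S: "finite S" "\<And>x. x \<notin> S \<Longrightarrow> g x = f x"
  shows "g summable_on UNIV" "infsum g UNIV = infsum f UNIV + (\<Sum>x\<in>S. g x - f x)"
proof -
  have "((\<lambda>x. g x - f x) has_sum (\<Sum>x\<in>S. g x - f x)) UNIV"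
    using S by (intro has_sum_finite_neutralI) auto
  from has_sum_add[OF has_sum_infsum[OF f] this]
  have "(g has_sum (infsum f UNIV + (\<Sum>x\<in>S. g x - f x))) UNIV" by simp
  then show "g summable_on UNIV" "infsum g UNIV = infsum f UNIV + (\<Sum>x\<in>S. g x - f x)"
    by (auto simp: has_sum_imp_summable infsumI)
qed

lemma integral_count_space_eq_infsum:
  fixes f :: "'a \<Rightarrow> real"
  assumes "f summable_on UNIV"
  shows "integrable (count_space UNIV) f" "(\<integral>x. f x \<partial>count_space UNIV) = infsum f UNIV"
proof -
  have "Infinite_Set_Sum.abs_summable_on f UNIV"
    using assms summable_on_iff_abs_summable_on_real[of f UNIV] abs_summable_equivalent[of f UNIV] by simp
  then show "integrable (count_space UNIV) f" "(\<integral>x. f x \<partial>count_space UNIV) = infsum f UNIV"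
    using infsetsum_infsum[of f UNIV] unfolding abs_summable_on_def infsetsum_def by auto
qed

lemma integrable_count_space_summable:
  fixes f :: "'a \<Rightarrow> real"
  assumes "integrable (count_space UNIV) f"
  shows "f summable_on UNIV"
  using assms summable_on_iff_abs_summable_on_real[of f UNIV] abs_summable_equivalent[of f UNIV]
  unfolding abs_summable_on_def by simp

lemma ext_integral_count_space:
  "f summable_on UNIV \<Longrightarrow> ext_integral (count_space UNIV) f = ereal (infsum f UNIV)"
  using integral_count_space_eq_infsum[of f] by (simp add: ext_integral_eq_integral)

text \<open>
  This makes finiteness of the energy a summability statement: the entropy integrand has a
  summable positive part, so its extended integral can only fail to be finite by being \<open>-\<infinity>\<close>.
\<close>
lemma ext_integral_not_minf_imp_summable:
  fixes f :: "'a \<Rightarrow> real"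
  assumes pos: "(\<lambda>x. max 0 (f x)) summable_on UNIV"
    and fin: "ext_integral (count_space UNIV) f \<noteq> -\<infinity>"
  shows "f summable_on UNIV"
proof (rule integrable_count_space_summable)
  have "integrable (count_space UNIV) (\<lambda>x. max 0 (f x))"
    using pos by (rule integral_count_space_eq_infsum)
  then have P: "(\<integral>\<^sup>+x. ennreal (f x) \<partial>count_space UNIV) \<noteq> \<infinity>"
    by (simp add: real_integrable_def ennreal_max_0)
  moreover have "(\<integral>\<^sup>+x. ennreal (- f x) \<partial>count_space UNIV) \<noteq> \<infinity>"
  proof
    assume N: "(\<integral>\<^sup>+x. ennreal (- f x) \<partial>count_space UNIV) = \<infinity>"
    have "enn2ereal (\<integral>\<^sup>+x. ennreal (f x) \<partial>count_space UNIV) \<noteq> \<infinity>"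
      using P by (metis enn2ereal_top enn2ereal_inject infinity_ennreal_def)
    with fin N show False
      unfolding ext_integral_def
      by (cases "enn2ereal (\<integral>\<^sup>+x. ennreal (f x) \<partial>count_space UNIV)") auto
  qed
  ultimately show "integrable (count_space UNIV) f"
    by (simp add: real_integrable_def)
qed

section \<open>Graph distance and automorphisms\<close>

lemma relpow_graph_dist:
  assumes "graph_connected E"
  shows "(x, y) \<in> E ^^ graph_dist E x y"
proof -
  obtain n where "(x, y) \<in> E ^^ n"
    using assms rtrancl_imp_relpow unfolding graph_connected_def by blast
  then show ?thesis unfolding graph_dist_def by (rule LeastI)
qed

lemma graph_dist_le: "(x, y) \<in> E ^^ n \<Longrightarrow> graph_dist E x y \<le> n"
  unfolding graph_dist_def by (rule Least_le)

lemma finite_graph_ball: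
  assumes E: "graph_connected E" "sym E" "\<And>x. finite (E `` {x})"
  shows "finite {x. graph_dist E x x0 \<le> R}"
proof -
  have "finite {x. (x, x0) \<in> E ^^ j}" for j
  proof (induction j)
    case (Suc j)
    have "{x. (x, x0) \<in> E ^^ Suc j} \<subseteq> (\<Union>y\<in>{y. (y, x0) \<in> E ^^ j}. E `` {y})"
      using relpow_Suc_D2[of _ x0 j E] E(2) by (fastforce dest: symD)
    then show ?case using Suc E(3) by (meson finite_UN_I finite_subset)
  qed simp
  moreover have "{x. graph_dist E x x0 \<le> R} \<subseteq> (\<Union>j\<le>R. {x. (x, x0) \<in> E ^^ j})"
    using relpow_graph_dist[OF E(1)] by fastforce
  ultimately show ?thesis by (meson finite_UN_I finite_atMost finite_subset)
qed

lemma automorphism_relpow: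
  assumes "\<And>x y. (x, y) \<in> E \<Longrightarrow> (g x, g y) \<in> E" "(x, y) \<in> E ^^ n"
  shows "(g x, g y) \<in> E ^^ n"
  using assms(2)
proof (induction n arbitrary: y)
  case (Suc n)
  then obtain z where "(x, z) \<in> E ^^ n" "(z, y) \<in> E" by auto
  with Suc assms(1) show ?case by auto
qed simp

text \<open>
  Automorphisms preserve distances, so if they move one vertex to infinity they move
  every vertex to infinity.
\<close>
lemma automorphisms_to_infinity:
  assumes E: "graph_connected E"
    and g: "\<And>n x y. (x, y) \<in> E \<Longrightarrow> (g n x, g n y) \<in> E"
    and z: "\<And>R. \<forall>\<^sub>F n in F. \<not> graph_dist E (g n z) x0 \<le> R"
  shows "filterlim (\<lambda>n. g n y) (at_graph_infinity E x0) F"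
  unfolding at_graph_infinity_def filterlim_filtercomap_iff filterlim_at_top
proof
  fix R
  obtain k where k: "(z, y) \<in> E ^^ k"
    using relpow_graph_dist[OF E] by blast
  have "\<forall>\<^sub>F n in F. \<not> graph_dist E (g n z) x0 \<le> k + R" by (rule z)
  then show "\<forall>\<^sub>F n in F. R \<le> ((\<lambda>x. graph_dist E x x0) \<circ> (\<lambda>n. g n y)) n"
  proof (rule eventually_mono)
    fix n assume n: "\<not> graph_dist E (g n z) x0 \<le> k + R"
    have "(g n z, g n y) \<in> E ^^ k"
      using automorphism_relpow[of E "g n"] g k by blast
    with relpow_graph_dist[OF E, of "g n y" x0]
    have "(g n z, x0) \<in> E ^^ (k + graph_dist E (g n y) x0)"
      unfolding relpow_add by blast
    from graph_dist_le[OF this] n show "R \<le> ((\<lambda>x. graph_dist E x x0) \<circ> (\<lambda>n. g n y)) n"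
      by simp
  qed
qed

lemma automorphism_neighbours:
  assumes "bij g" "\<And>x y. (g x, g y) \<in> E \<longleftrightarrow> (x, y) \<in> E"
  shows "E `` {g x} = g ` (E `` {x})"
proof -
  have "y \<in> g ` (E `` {x})" if "(g x, y) \<in> E" for y
  proof -
    obtain z where "y = g z" using assms(1) by (metis bij_pointE)
    with that assms(2) show ?thesis by auto
  qed
  then show ?thesis using assms(2) by auto
qed

lemma card_neighbours_automorphism:
  assumes "bij g" "\<And>x y. (g x, g y) \<in> E \<longleftrightarrow> (x, y) \<in> E"
  shows "card (E `` {g x}) = card (E `` {x})"
  using assms(1) unfolding automorphism_neighbours[OF assms]
  by (simp add: card_image bij_def inj_on_def)

lemma finitely_many_orbits_representatives:
  assumes sub: "subgroup \<Gamma> (graph_Aut E)" and orb: "finitely_many_orbits E \<Gamma>"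
  obtains Z where "finite Z" "\<And>x. \<exists>z\<in>Z. \<exists>g\<in>\<Gamma>. g z = x"
proof -
  let ?O = "orbit (graph_Aut E\<lparr>carrier := \<Gamma>\<rparr>) id"
  have "finite (range ?O)"
    using orb unfolding finitely_many_orbits_def orbits_def by (simp add: full_SetCompr_eq)
  then obtain Z where Z: "finite Z" "range ?O = ?O ` Z"
    using finite_subset_image[of "range ?O" ?O UNIV] by auto
  have id: "(\<lambda>x. x) \<in> \<Gamma>"
    using subgroup.one_closed[OF sub] by (simp add: graph_Aut_def BijGroup_def restrict_def)
  have "\<exists>z\<in>Z. \<exists>g\<in>\<Gamma>. g z = x" for x
  proof -
    have self: "x \<in> ?O x" using id by (auto simp: orbit_def intro!: exI[of _ "\<lambda>x. x"])
    have "?O x \<in> ?O ` Z" unfolding Z(2)[symmetric] by (rule rangeI)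
    then obtain z where z: "z \<in> Z" "?O x = ?O z" by (rule imageE) 
    have "x \<in> ?O z" using self unfolding z(2) .
    then obtain g where "g \<in> \<Gamma>" "g z = x" unfolding orbit_def by auto
    with z(1) show ?thesis by blast
  qed
  with Z(1) show thesis using that by blast
qed

lemma subgroup_graph_Aut:
  assumes "subgroup \<Gamma> (graph_Aut E)" "g \<in> \<Gamma>"
  shows "bij g" "(g x, g y) \<in> E \<longleftrightarrow> (x, y) \<in> E"
  using subgroup.subset[OF assms(1)] assms(2) by (auto simp: graph_Aut_def Bij_def)

section \<open>The Nehari functional\<close>

definition mass :: "real \<Rightarrow> ('v \<Rightarrow> real) \<Rightarrow> real" where
  "mass p u = (\<Sum>\<^sub>\<infinity>x. \<bar>u x\<bar> powr p)"

definition finite_entropy :: "real \<Rightarrow> ('v \<Rightarrow> real) \<Rightarrow> bool" where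
  "finite_entropy p u \<longleftrightarrow> (\<lambda>x. \<bar>u x\<bar> powr p) summable_on UNIV \<and>
     (\<lambda>x. \<bar>u x\<bar> powr p * ln (\<bar>u x\<bar> powr p)) summable_on UNIV"

definition nehari_density ::
    "real \<Rightarrow> ('v \<times> 'v) set \<Rightarrow> ('v \<Rightarrow> real) \<Rightarrow> ('v \<Rightarrow> real) \<Rightarrow> 'v \<Rightarrow> real" where
  "nehari_density p E V u x = grad_norm p E u x powr p + V x * \<bar>u x\<bar> powr p
     - \<bar>u x\<bar> powr p * ln (\<bar>u x\<bar> powr p)"

text \<open>
  This is \<open>\<integral> (|\<nabla>u|\<^sup>p + V |u|\<^sup>p) - \<integral> |u|\<^sup>p log |u|\<^sup>p\<close>, whose zeros apart from the zero function form the Nehari manifold. Writing it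
  as one sum of densities lets Fatou's lemma and changes at finitely many vertices act on all terms
  simultaneously.
\<close>
definition nehari_functional ::
    "real \<Rightarrow> ('v \<times> 'v) set \<Rightarrow> ('v \<Rightarrow> real) \<Rightarrow> ('v \<Rightarrow> real) \<Rightarrow> real" where
  "nehari_functional p E V u = (\<Sum>\<^sub>\<infinity>x. nehari_density p E V u x)"

definition cutoff :: "'v set \<Rightarrow> ('v \<Rightarrow> real) \<Rightarrow> 'v \<Rightarrow> real" where
  "cutoff K u x = (if x \<in> K then u x else 0)"

text \<open>
  The price of cutting \<open>u\<close> along the edges between \<open>K\<close> and its complement, localised at the vertex \<open>x\<close>;
  the factor \<open>1 / 2\<close> is the one in the gradient.
\<close>
definition boundary_mass :: "real \<Rightarrow> ('v \<times> 'v) set \<Rightarrow> 'v set \<Rightarrow> ('v \<Rightarrow> real) \<Rightarrow> 'v \<Rightarrow> real" where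
  "boundary_mass p E K u x =
     (\<Sum>y\<in>E `` {x}. if (x \<in> K) \<noteq> (y \<in> K) then \<bar>u x\<bar> powr p + \<bar>u y\<bar> powr p else 0) / 2"

lemma mass_nonneg: "mass p u \<ge> 0"
  unfolding mass_def by (rule infsum_nonneg) simp

locale bounded_degree_graph =
  fixes p :: real and E :: "('v \<times> 'v) set" and D :: nat
  assumes p_gt_1: "p > 1"
    and sym_E: "sym E"
    and finite_nbrs: "\<And>x. finite (E `` {x})"
    and card_nbrs: "\<And>x. card (E `` {x}) \<le> D"
begin

lemma grad_norm_powr:
  "grad_norm p E u x powr p = 1 / 2 * (\<Sum>y\<in>E `` {x}. \<bar>u y - u x\<bar> powr p)"
  using p_gt_1 unfolding grad_norm_def
  by (simp add: powr_powr sum_nonneg)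

text \<open>
  Exchange the order of summation: by symmetry of the adjacency relation each \<open>y\<close> is counted at most
  \<open>D\<close> times. This is what identifies \<open>W\<^sup>1\<^sup>,\<^sup>p\<close> with \<open>\<ell>\<^sup>p\<close>.
\<close>
lemma neighbour_sum:
  fixes f :: "'v \<Rightarrow> real"
  assumes f: "f summable_on UNIV" and nn: "\<And>x. f x \<ge> 0"
  shows "(\<lambda>x. \<Sum>y\<in>E `` {x}. f y) summable_on UNIV"
    and "(\<Sum>\<^sub>\<infinity>x. \<Sum>y\<in>E `` {x}. f y) \<le> D * infsum f UNIV"
proof -
  have bound: "(\<Sum>x\<in>K. \<Sum>y\<in>E `` {x}. f y) \<le> D * infsum f UNIV" if K: "finite K" for K
  proof -
    have fin: "finite (E `` K)"
      using K finite_nbrs by (subst Image_eq_UN) auto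
    have "(\<Sum>x\<in>K. \<Sum>y\<in>E `` {x}. f y) = (\<Sum>x\<in>K. \<Sum>y | y \<in> E `` K \<and> (x, y) \<in> E. f y)"
      by (intro sum.cong refl) auto
    also have "\<dots> = (\<Sum>y\<in>E `` K. \<Sum>x | x \<in> K \<and> (x, y) \<in> E. f y)"
      using K fin by (rule sum.swap_restrict)
    also have "\<dots> = (\<Sum>y\<in>E `` K. card {x \<in> K. (x, y) \<in> E} * f y)"
      by simp
    also have "\<dots> \<le> (\<Sum>y\<in>E `` K. D * f y)"
    proof (intro sum_mono mult_right_mono nn)
      fix y
      have "card {x \<in> K. (x, y) \<in> E} \<le> card (E `` {y})"
        using sym_E by (intro card_mono finite_nbrs) (auto dest: symD)
      then show "real (card {x \<in> K. (x, y) \<in> E}) \<le> real D"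
        using card_nbrs[of y] by simp
    qed
    also have "\<dots> = D * sum f (E `` K)" by (simp add: sum_distrib_left)
    also have "\<dots> \<le> D * infsum f UNIV"
      using f nn fin by (intro mult_left_mono sum_le_infsum) auto
    finally show ?thesis .
  qed
  show "(\<lambda>x. \<Sum>y\<in>E `` {x}. f y) summable_on UNIV"
    and "(\<Sum>\<^sub>\<infinity>x. \<Sum>y\<in>E `` {x}. f y) \<le> D * infsum f UNIV"
    using nonneg_infsum_le[OF _ bound] nn by (auto intro: sum_nonneg)
qed

lemma gradient_le_mass:
  assumes u: "(\<lambda>x. \<bar>u x\<bar> powr p) summable_on UNIV"
  shows "(\<lambda>x. grad_norm p E u x powr p) summable_on UNIV"
    and "(\<Sum>\<^sub>\<infinity>x. grad_norm p E u x powr p) \<le> 2 powr p * D * mass p u"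
proof -
  let ?w = "\<lambda>x. \<bar>u x\<bar> powr p"
  let ?g = "\<lambda>x. 2 powr p / 2 * ((\<Sum>y\<in>E `` {x}. ?w y) + D * ?w x)"
  have le: "grad_norm p E u x powr p \<le> ?g x" for x
  proof -
    have "(\<Sum>y\<in>E `` {x}. \<bar>u y - u x\<bar> powr p) \<le> (\<Sum>y\<in>E `` {x}. 2 powr p * (?w y + ?w x))"
      using p_gt_1 by (intro sum_mono abs_diff_powr_le) auto
    also have "\<dots> = 2 powr p * ((\<Sum>y\<in>E `` {x}. ?w y) + card (E `` {x}) * ?w x)"
      by (simp add: sum_distrib_left[symmetric] sum.distrib)
    also have "\<dots> \<le> 2 powr p * ((\<Sum>y\<in>E `` {x}. ?w y) + D * ?w x)"
      using card_nbrs[of x] by (intro mult_left_mono add_left_mono mult_right_mono) auto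
    finally show ?thesis by (simp add: grad_norm_powr)
  qed
  note ns = neighbour_sum[OF u]
  have s: "?g summable_on UNIV"
    using u ns(1) by (intro summable_on_cmult_right summable_on_add) auto
  show g: "(\<lambda>x. grad_norm p E u x powr p) summable_on UNIV"
    using le by (intro summable_on_comparison_real[OF s]) auto
  have "(\<Sum>\<^sub>\<infinity>x. grad_norm p E u x powr p) \<le> infsum ?g UNIV"
    using le by (intro infsum_mono g s) auto
  also have "\<dots> = 2 powr p / 2 * ((\<Sum>\<^sub>\<infinity>x. \<Sum>y\<in>E `` {x}. ?w y) + D * mass p u)"
    using u ns(1) unfolding mass_def
    by (subst infsum_cmult_right', subst infsum_add) (auto intro: summable_on_cmult_right simp: infsum_cmult_right')
  also have "\<dots> \<le> 2 powr p / 2 * (D * mass p u + D * mass p u)"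
    using ns(2) unfolding mass_def by (intro mult_left_mono add_right_mono) auto
  finally show "(\<Sum>\<^sub>\<infinity>x. grad_norm p E u x powr p) \<le> 2 powr p * D * mass p u"
    by (simp add: algebra_simps)
qed

lemma potential_summable:
  assumes u: "(\<lambda>x. \<bar>u x\<bar> powr p) summable_on UNIV" and V: "\<And>x. \<bar>V x\<bar> \<le> B"
  shows "(\<lambda>x. V x * \<bar>u x\<bar> powr p) summable_on UNIV"
proof (rule summable_on_comparison_real)
  show "(\<lambda>x. B * \<bar>u x\<bar> powr p) summable_on UNIV" using u by (rule summable_on_cmult_right)
  show "\<bar>V x * \<bar>u x\<bar> powr p\<bar> \<le> B * \<bar>u x\<bar> powr p" for x
    using V[of x] by (simp add: abs_mult mult_right_mono)
qed

lemma nehari_density_summable: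
  assumes "finite_entropy p u" "\<And>x. \<bar>V x\<bar> \<le> B"
  shows "nehari_density p E V u summable_on UNIV"
  using assms unfolding finite_entropy_def nehari_density_def
  by (intro infsum_diff_real summable_on_add gradient_le_mass potential_summable) auto

text \<open>
  The logarithm is the only inhomogeneous term; it turns scaling by \<open>c\<close> into an additive multiple of the
  mass. The ray through a nonzero admissible function therefore meets the Nehari manifold
  exactly once.
\<close>
lemma nehari_functional_scale:
  assumes u: "finite_entropy p u" and V: "\<And>x. \<bar>V x\<bar> \<le> B" and c: "c > 0"
  shows "finite_entropy p (\<lambda>x. c * u x)"
    and "mass p (\<lambda>x. c * u x) = c powr p * mass p u"
    and "nehari_functional p E V (\<lambda>x. c * u x) =
           c powr p * nehari_functional p E V u - c powr p * ln (c powr p) * mass p u"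
proof -
  have w: "\<bar>c * t\<bar> powr p = c powr p * \<bar>t\<bar> powr p" for t
    using c by (simp add: abs_mult powr_mult)
  have e: "\<bar>c * t\<bar> powr p * ln (\<bar>c * t\<bar> powr p) =
      c powr p * (\<bar>t\<bar> powr p * ln (\<bar>t\<bar> powr p)) + c powr p * ln (c powr p) * \<bar>t\<bar> powr p" for t
    using c by (cases "t = 0") (simp_all add: w ln_mult algebra_simps)
  have g: "grad_norm p E (\<lambda>x. c * u x) x powr p = c powr p * grad_norm p E u x powr p" for x
    by (simp add: grad_norm_powr w sum_distrib_left flip: right_diff_distrib)
  show "mass p (\<lambda>x. c * u x) = c powr p * mass p u"
    by (simp add: mass_def w infsum_cmult_right')
  show "finite_entropy p (\<lambda>x. c * u x)"
    using u unfolding finite_entropy_def e unfolding w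
    by (intro conjI summable_on_cmult_right summable_on_add) auto
  have d: "nehari_density p E V (\<lambda>x. c * u x) x =
      c powr p * nehari_density p E V u x - c powr p * ln (c powr p) * \<bar>u x\<bar> powr p" for x
    unfolding nehari_density_def e by (simp add: g w algebra_simps)
  show "nehari_functional p E V (\<lambda>x. c * u x) =
           c powr p * nehari_functional p E V u - c powr p * ln (c powr p) * mass p u"
    using u nehari_density_summable[OF u V] unfolding nehari_functional_def d mass_def
    by (subst infsum_diff_real)
      (auto intro!: summable_on_cmult_right simp: infsum_cmult_right' finite_entropy_def)
qed

lemma nehari_functional_automorphism:
  assumes b: "bij g" and g: "\<And>x y. (g x, g y) \<in> E \<longleftrightarrow> (x, y) \<in> E"
  shows "finite_entropy p (\<lambda>x. u (g x)) \<longleftrightarrow> finite_entropy p u"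
    and "mass p (\<lambda>x. u (g x)) = mass p u"
    and "nehari_functional p E (\<lambda>x. V (g x)) (\<lambda>x. u (g x)) = nehari_functional p E V u"
proof -
  note nb = automorphism_neighbours[OF b g]
  have gr: "grad_norm p E (\<lambda>x. u (g x)) x = grad_norm p E u (g x)" for x
    unfolding grad_norm_def nb using b
    by (subst sum.reindex) (auto simp: bij_def inj_on_def o_def)
  note re = infsum_reindex_bij_betw[OF b] summable_on_reindex_bij_betw[OF b]
  show "mass p (\<lambda>x. u (g x)) = mass p u"
    unfolding mass_def by (rule re(1))
  show "finite_entropy p (\<lambda>x. u (g x)) \<longleftrightarrow> finite_entropy p u"
    unfolding finite_entropy_def
    using re(2)[of "\<lambda>x. \<bar>u x\<bar> powr p"] re(2)[of "\<lambda>x. \<bar>u x\<bar> powr p * ln (\<bar>u x\<bar> powr p)"] by simp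
  have "nehari_density p E (\<lambda>x. V (g x)) (\<lambda>x. u (g x)) x = nehari_density p E V u (g x)" for x
    by (simp add: nehari_density_def gr)
  then have "nehari_density p E (\<lambda>x. V (g x)) (\<lambda>x. u (g x)) = (\<lambda>x. nehari_density p E V u (g x))"
    by (rule ext)
  then show "nehari_functional p E (\<lambda>x. V (g x)) (\<lambda>x. u (g x)) = nehari_functional p E V u"
    unfolding nehari_functional_def by (simp add: re(1))
qed

lemma finite_entropy_cutoff:
  assumes "finite_entropy p u"
  shows "finite_entropy p (cutoff A u)"
proof -
  have "(\<lambda>x. \<bar>cutoff A u x\<bar> powr p) = (\<lambda>x. if x \<in> A then \<bar>u x\<bar> powr p else 0)"
    "(\<lambda>x. \<bar>cutoff A u x\<bar> powr p * ln (\<bar>cutoff A u x\<bar> powr p)) =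
       (\<lambda>x. if x \<in> A then \<bar>u x\<bar> powr p * ln (\<bar>u x\<bar> powr p) else 0)"
    by (auto simp: cutoff_def fun_eq_iff)
  with assms show ?thesis
    unfolding finite_entropy_def by (simp add: summable_on_if_real)
qed

lemma mass_cutoff_finite:
  assumes "finite K"
  shows "mass p (cutoff K u) = (\<Sum>x\<in>K. \<bar>u x\<bar> powr p)"
proof -
  have "mass p (cutoff K u) = infsum (\<lambda>x. \<bar>u x\<bar> powr p) K"
    unfolding mass_def by (rule infsum_cong_neutral) (auto simp: cutoff_def)
  with assms show ?thesis by simp
qed

lemma mass_cutoff_Compl:
  assumes "(\<lambda>x. \<bar>u x\<bar> powr p) summable_on UNIV"
  shows "mass p (cutoff K u) + mass p (cutoff (- K) u) = mass p u"
proof -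
  have eq: "\<bar>cutoff A u x\<bar> powr p = (if x \<in> A then \<bar>u x\<bar> powr p else 0)" for A x
    by (simp add: cutoff_def)
  show ?thesis
    unfolding mass_def eq using assms
    by (subst infsum_add[symmetric])
      (auto intro!: summable_on_if_real[where A = "- K", simplified] summable_on_if_real infsum_cong)
qed

text \<open>
  Functions with disjoint supports have additive mass, potential energy and entropy. The gradient is
  additive except on edges joining \<open>K\<close> to its complement, where \<open>|u x|\<^sup>p + |u y|\<^sup>p\<close> replaces
  \<open>|u y - u x|\<^sup>p\<close>; the latter is bounded below by \<open>0\<close>.
\<close>
lemma nehari_functional_cutoff:
  assumes K: "finite K" and u: "finite_entropy p u" and V: "\<And>x. \<bar>V x\<bar> \<le> B"
  shows "nehari_functional p E V (cutoff K u) + nehari_functional p E V (cutoff (- K) u)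
      \<le> nehari_functional p E V u + (\<Sum>x\<in>K \<union> E `` K. boundary_mass p E K u x)"
proof -
  let ?d = "nehari_density p E V" and ?b = "boundary_mass p E K u"
  have fin: "finite (K \<union> E `` K)"
    using K finite_nbrs by (subst Image_eq_UN) auto
  have b0: "?b x = 0" if "x \<notin> K \<union> E `` K" for x
  proof -
    have "(\<Sum>y\<in>E `` {x}. if (x \<in> K) \<noteq> (y \<in> K) then \<bar>u x\<bar> powr p + \<bar>u y\<bar> powr p else 0) = 0"
    proof (rule sum.neutral, rule ballI)
      fix y assume "y \<in> E `` {x}"
      then have "y \<notin> K" using that sym_E by (auto dest: symD)
      then show "(if (x \<in> K) \<noteq> (y \<in> K) then \<bar>u x\<bar> powr p + \<bar>u y\<bar> powr p else 0) = 0"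
        using that by auto
    qed
    then show ?thesis by (simp add: boundary_mass_def)
  qed
  have bs: "?b summable_on UNIV" "infsum ?b UNIV = (\<Sum>x\<in>K \<union> E `` K. ?b x)"
  proof -
    have "(?b has_sum (\<Sum>x\<in>K \<union> E `` K. ?b x)) UNIV"
      using fin b0 by (intro has_sum_finite_neutralI) auto
    then show "?b summable_on UNIV" "infsum ?b UNIV = (\<Sum>x\<in>K \<union> E `` K. ?b x)"
      by (auto simp: has_sum_imp_summable infsumI)
  qed
  have grad: "grad_norm p E (cutoff K u) x powr p + grad_norm p E (cutoff (- K) u) x powr p
      \<le> grad_norm p E u x powr p + ?b x" for x
  proof -
    have "\<bar>cutoff K u y - cutoff K u x\<bar> powr p + \<bar>cutoff (- K) u y - cutoff (- K) u x\<bar> powr p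
       \<le> \<bar>u y - u x\<bar> powr p
         + (if (x \<in> K) \<noteq> (y \<in> K) then \<bar>u x\<bar> powr p + \<bar>u y\<bar> powr p else 0)" for y
      by (auto simp: cutoff_def)
    then have "(\<Sum>y\<in>E `` {x}. \<bar>cutoff K u y - cutoff K u x\<bar> powr p
          + \<bar>cutoff (- K) u y - cutoff (- K) u x\<bar> powr p)
       \<le> (\<Sum>y\<in>E `` {x}. \<bar>u y - u x\<bar> powr p
         + (if (x \<in> K) \<noteq> (y \<in> K) then \<bar>u x\<bar> powr p + \<bar>u y\<bar> powr p else 0))"
      by (intro sum_mono) 
    then show ?thesis
      unfolding grad_norm_powr boundary_mass_def sum.distrib by (simp add: field_simps)
  qed
  have dens: "?d (cutoff K u) x + ?d (cutoff (- K) u) x \<le> ?d u x + ?b x" for x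
    using grad[of x] unfolding nehari_density_def by (auto simp: cutoff_def)
  note sm = nehari_density_summable[OF _ V]
  note fc = finite_entropy_cutoff[OF u]
  have "(\<Sum>\<^sub>\<infinity>x. ?d (cutoff K u) x + ?d (cutoff (- K) u) x) \<le> (\<Sum>\<^sub>\<infinity>x. ?d u x + ?b x)"
    using dens by (intro infsum_mono summable_on_add sm fc u bs) auto
  then show ?thesis
    unfolding nehari_functional_def
    by (simp add: infsum_add sm fc u bs)
qed

text \<open>
  The lower bound \<open>m\<close> on the unit sphere, transported by scaling to all masses. The term \<open>- M ln M\<close> is
  strictly concave in \<open>M\<close>, which is what forbids a minimising sequence to split.
\<close>
lemma nehari_functional_ge:
  assumes V: "\<And>x. \<bar>V x\<bar> \<le> B"
    and m: "\<And>u. finite_entropy p u \<Longrightarrow> mass p u = 1 \<Longrightarrow> m \<le> nehari_functional p E V u"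
    and u: "finite_entropy p u"
  shows "m * mass p u - mass p u * ln (mass p u) \<le> nehari_functional p E V u"
proof (cases "mass p u = 0")
  case True
  have "\<bar>u x\<bar> powr p = 0" for x
    using sum_le_infsum[of "\<lambda>x. \<bar>u x\<bar> powr p" "{x}"] u True
    by (auto simp: finite_entropy_def mass_def)
  then have "u = (\<lambda>_. 0)" by auto
  then show ?thesis
    by (simp add: nehari_functional_def nehari_density_def grad_norm_powr mass_def)
next
  case False
  define a where "a = mass p u"
  have a: "a > 0" using False mass_nonneg[of p u] unfolding a_def by linarith
  \<comment> \<open>Normalises the mass to \<open>1\<close>.\<close>
  define c where "c = a powr (- 1 / p)"
  have c: "c > 0" "c powr p = 1 / a"
    using a p_gt_1 powr_powr[of a "- 1 / p" p] powr_minus_divide[of a 1] by (auto simp: c_def simp del: powr_powr)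
  note sc = nehari_functional_scale[OF u V c(1)]
  have "m \<le> nehari_functional p E V (\<lambda>x. c * u x)"
    using sc a c by (intro m) (auto simp: a_def)
  also have "\<dots> = nehari_functional p E V u / a + ln a"
    using a by (simp add: sc(3) c(2) ln_div flip: a_def)
  finally show ?thesis using a by (simp add: field_simps flip: a_def)
qed

section \<open>Non-vanishing\<close>

lemma powr_le_1:
  assumes "(\<lambda>x. \<bar>u x\<bar> powr p) summable_on UNIV" "mass p u = 1"
  shows "\<bar>u x\<bar> powr p \<le> 1"
  using sum_le_infsum[of "\<lambda>x. \<bar>u x\<bar> powr p" "{x}"] assms by (simp add: mass_def)

lemma mult_ln_nonpos:
  fixes w :: real
  assumes "0 \<le> w" "w \<le> 1"
  shows "w * ln w \<le> 0"
  using assms by (cases "w = 0") (auto simp: mult_le_0_iff)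

lemma nehari_density_ge:
  assumes "V x \<ge> -1" "\<bar>u x\<bar> powr p \<le> 1"
  shows "nehari_density p E V u x \<ge> - (\<bar>u x\<bar> powr p)"
proof -
  have "(V x + 1) * \<bar>u x\<bar> powr p \<ge> 0" using assms(1) by simp
  moreover have "\<bar>u x\<bar> powr p * ln (\<bar>u x\<bar> powr p) \<le> 0"
    using assms(2) by (intro mult_ln_nonpos) auto
  moreover have "grad_norm p E u x powr p \<ge> 0" by simp
  ultimately show ?thesis unfolding nehari_density_def distrib_right by linarith
qed

lemma nehari_functional_ge_minus1:
  assumes u: "finite_entropy p u" "mass p u = 1" and V: "\<And>x. V x \<ge> -1" "\<And>x. \<bar>V x\<bar> \<le> B"
  shows "nehari_functional p E V u \<ge> -1"
proof -
  have s: "(\<lambda>x. \<bar>u x\<bar> powr p) summable_on UNIV" using u by (simp add: finite_entropy_def)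
  have "(\<Sum>\<^sub>\<infinity>x. - (\<bar>u x\<bar> powr p)) \<le> nehari_functional p E V u"
    unfolding nehari_functional_def using u V s
    by (intro infsum_mono nehari_density_summable nehari_density_ge[OF V(1) powr_le_1[OF s u(2)]])
      (auto simp: summable_on_uminus)
  then show ?thesis using u(2) by (simp add: infsum_uminus mass_def)
qed

text \<open>
  If all values of \<open>w = |u|\<^sup>p\<close> were below \<open>exp (- (C + 2))\<close>, the entropy \<open>- \<Sum> w ln w\<close> would be at
  least \<open>C + 2\<close>. As \<open>V \<ge> -1\<close>, the potential can lower this by at most \<open>1\<close>, and the total would exceed \<open>C\<close>.
\<close>
lemma entropy_concentration:
  assumes u: "finite_entropy p u" "mass p u = 1" and V: "\<And>x. V x \<ge> -1" "\<And>x. \<bar>V x\<bar> \<le> B"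
    and C: "nehari_functional p E V u \<le> C"
  shows "\<exists>x. \<bar>u x\<bar> powr p \<ge> exp (- (C + 2))"
proof (rule ccontr)
  assume "\<not> ?thesis"
  then have small: "\<bar>u x\<bar> powr p < exp (- (C + 2))" for x by (auto simp: not_le)
  have s: "(\<lambda>x. \<bar>u x\<bar> powr p) summable_on UNIV" using u by (simp add: finite_entropy_def)
  have "(C + 1) * \<bar>u x\<bar> powr p \<le> nehari_density p E V u x" for x
  proof -
    let ?w = "\<bar>u x\<bar> powr p"
    have "(V x + 1) * ?w \<ge> 0" using V(1)[of x] by simp
    then have "V x * ?w + ?w \<ge> 0" by (simp only: distrib_right mult_1)
    moreover have "?w * ln ?w \<le> - (C + 2) * ?w"
    proof (cases "?w = 0")
      case False
      then have w: "?w > 0" by simp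
      then have "ln ?w < ln (exp (- (C + 2)))"
        using small[of x] by (subst ln_less_cancel_iff) auto
      then have "ln ?w \<le> - (C + 2)" by simp
      from mult_left_mono[OF this, of ?w] show ?thesis by (simp add: mult.commute del: ln_powr)
    qed simp
    then have "?w * ln ?w \<le> - (C * ?w) - 2 * ?w" by (simp only: left_diff_distrib minus_add_distrib distrib_right minus_mult_left)
    moreover have "grad_norm p E u x powr p \<ge> 0" by simp
    ultimately show ?thesis unfolding nehari_density_def distrib_right mult_1 by linarith
  qed
  then have "(\<Sum>\<^sub>\<infinity>x. (C + 1) * \<bar>u x\<bar> powr p) \<le> nehari_functional p E V u"
    unfolding nehari_functional_def using u V s
    by (intro infsum_mono nehari_density_summable summable_on_cmult_right) auto
  then show False using u(2) C by (simp add: infsum_cmult_right' mass_def)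
qed

lemma nehari_functional_abs:
  assumes u: "finite_entropy p u" and V: "\<And>x. \<bar>V x\<bar> \<le> B"
  shows "finite_entropy p (\<lambda>x. \<bar>u x\<bar>)" "mass p (\<lambda>x. \<bar>u x\<bar>) = mass p u"
    "nehari_functional p E V (\<lambda>x. \<bar>u x\<bar>) \<le> nehari_functional p E V u"
proof -
  show f: "finite_entropy p (\<lambda>x. \<bar>u x\<bar>)" "mass p (\<lambda>x. \<bar>u x\<bar>) = mass p u"
    using u by (auto simp: finite_entropy_def mass_def)
  have "grad_norm p E (\<lambda>x. \<bar>u x\<bar>) x powr p \<le> grad_norm p E u x powr p" for x
    unfolding grad_norm_powr using p_gt_1
    by (intro mult_left_mono sum_mono powr_mono2) auto
  then show "nehari_functional p E V (\<lambda>x. \<bar>u x\<bar>) \<le> nehari_functional p E V u"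
    unfolding nehari_functional_def using u f V
    by (intro infsum_mono nehari_density_summable) (auto simp: nehari_density_def)
qed

section \<open>No loss of mass in the limit\<close>

text \<open>
  A polynomial minorant of the entropy: it passes to limits without regard to the singularity of the
  logarithm at \<open>0\<close>, and is still positive on \<open>(0, 1)\<close>.
\<close>
lemma entropy_ge_quadratic:
  fixes t :: real
  assumes "t \<ge> 0"
  shows "t * (1 - t) \<le> - (t * ln t)"
proof (cases "t = 0")
  case False
  then have "ln t \<le> t - 1" using assms by (intro ln_le_minus_one) auto
  from mult_left_mono[OF this assms] show ?thesis by (simp add: algebra_simps)
qed simp

lemma tendsto_abs_powr:
  "(f \<longlongrightarrow> t) F \<Longrightarrow> ((\<lambda>n. \<bar>f n\<bar> powr p) \<longlongrightarrow> \<bar>t\<bar> powr p) F"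
  using isCont_tendsto_compose[OF DERIV_isCont[OF has_real_derivative_abs_powr[OF p_gt_1]]] .

lemma tendsto_abs_powr_ln:
  "(f \<longlongrightarrow> t) F \<Longrightarrow> ((\<lambda>n. \<bar>f n\<bar> powr p * ln (\<bar>f n\<bar> powr p)) \<longlongrightarrow> \<bar>t\<bar> powr p * ln (\<bar>t\<bar> powr p)) F"
  using isCont_tendsto_compose[OF DERIV_isCont[OF has_real_derivative_abs_powr_ln[OF p_gt_1]]] .

lemma tendsto_nehari_density:
  assumes v: "\<And>x. ((\<lambda>n. v n x) \<longlongrightarrow> l x) F" and V: "((\<lambda>n. V n x) \<longlongrightarrow> W x) F"
  shows "((\<lambda>n. nehari_density p E (V n) (v n) x) \<longlongrightarrow> nehari_density p E W l x) F"
  unfolding nehari_density_def grad_norm_powr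
  by (rule tendsto_diff[OF _ tendsto_abs_powr_ln[OF v]])
    (intro tendsto_add tendsto_mult tendsto_sum tendsto_diff tendsto_const tendsto_abs_powr v V)

text \<open>
  The function \<open>f\<close> dominates every \<open>boundary_mass p E K u\<close> and is summable. Choose a finite set \<open>S\<close> outside
  of which \<open>f\<close> is small and let \<open>K\<close> contain \<open>S\<close> and its
  neighbours. Then no edge leaving \<open>K\<close> starts in \<open>S\<close>, so the boundary only sees the tail.
\<close>
lemma boundary_mass_small:
  assumes u: "(\<lambda>x. \<bar>u x\<bar> powr p) summable_on UNIV" and e: "e > 0"
  obtains K where "finite K" "z \<in> K" "(\<Sum>x\<in>K \<union> E `` K. boundary_mass p E K u x) < e"
proof -
  let ?w = "\<lambda>x. \<bar>u x\<bar> powr p"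
  define f where "f x = ((\<Sum>y\<in>E `` {x}. ?w y) + D * ?w x) / 2" for x
  have "(\<lambda>x. 1 / 2 * ((\<Sum>y\<in>E `` {x}. ?w y) + D * ?w x)) summable_on UNIV"
    using u by (intro summable_on_cmult_right summable_on_add neighbour_sum) auto
  then have "f summable_on UNIV" by (simp add: f_def[abs_def])
  moreover have "f x \<ge> 0" for x by (simp add: f_def sum_nonneg)
  ultimately obtain S where S: "finite S" "\<And>K. finite K \<Longrightarrow> K \<inter> S = {} \<Longrightarrow> sum f K < e"
    using e by (rule summable_tail) blast
  define K where "K = insert z (S \<union> E `` S)"
  have fin_Im: "finite (E `` A)" if "finite A" for A
    using that finite_nbrs by (subst Image_eq_UN) auto
  have K: "finite K" "z \<in> K" using S fin_Im by (auto simp: K_def)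
  have le: "boundary_mass p E K u x \<le> f x" for x
  proof -
    have "(\<Sum>y\<in>E `` {x}. if (x \<in> K) \<noteq> (y \<in> K) then ?w x + ?w y else 0) \<le> (\<Sum>y\<in>E `` {x}. ?w x + ?w y)"
      by (intro sum_mono) auto
    also have "\<dots> = card (E `` {x}) * ?w x + (\<Sum>y\<in>E `` {x}. ?w y)" by (simp add: sum.distrib)
    also have "\<dots> \<le> D * ?w x + (\<Sum>y\<in>E `` {x}. ?w y)"
      using card_nbrs[of x] by (intro add_right_mono mult_right_mono) auto
    finally show ?thesis unfolding boundary_mass_def f_def by simp
  qed
  have "boundary_mass p E K u x = 0" if "x \<in> S" for x
    unfolding boundary_mass_def using that by (auto simp: K_def intro!: sum.neutral)
  then have "(\<Sum>x\<in>K \<union> E `` K. boundary_mass p E K u x) = (\<Sum>x\<in>(K \<union> E `` K) - S. boundary_mass p E K u x)"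
    using K fin_Im by (intro sum.mono_neutral_right) auto
  also have "\<dots> \<le> (\<Sum>x\<in>(K \<union> E `` K) - S. f x)" by (intro sum_mono le)
  also have "\<dots> < e" using K fin_Im by (intro S) auto
  finally show thesis using that K by blast
qed

text \<open>
  The compactness step. Fatou's lemma, applied to the nonnegative density \<open>nehari_density + w\<close>, shows that
  the limit \<open>l\<close> is admissible with mass at most \<open>1\<close>. If its mass \<open>a\<close> were smaller than \<open>1\<close>, cut \<open>v n\<close> along a
  large finite set \<open>K\<close>: both pieces obey the scaled lower bound, so the functional exceeds \<open>m\<close> by about
  \<open>- a ln a - (1 - a) ln (1 - a)\<close> up to the boundary mass. This is strictly positive since
  \<open>l z \<noteq> 0\<close>, contradicting minimality. The potentials may vary with \<open>n\<close>, because translating the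
  minimising sequence translates \<open>V\<close>.
\<close>
lemma minimizing_filter_compact:
  fixes v V :: "'n \<Rightarrow> 'v \<Rightarrow> real" and l W :: "'v \<Rightarrow> real"
  assumes F: "F \<noteq> bot"
    and v: "\<And>n. finite_entropy p (v n)" "\<And>n. mass p (v n) = 1"
    and V: "\<And>n x. V n x \<ge> -1" "\<And>n x. \<bar>V n x\<bar> \<le> B"
    and m: "\<And>n u. finite_entropy p u \<Longrightarrow> mass p u = 1 \<Longrightarrow> m \<le> nehari_functional p E (V n) u"
    and lim: "((\<lambda>n. nehari_functional p E (V n) (v n)) \<longlongrightarrow> m) F"
    and l: "\<And>x. ((\<lambda>n. v n x) \<longlongrightarrow> l x) F"
    and W: "\<And>x. ((\<lambda>n. V n x) \<longlongrightarrow> W x) F" "\<And>x. \<bar>W x\<bar> \<le> B"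
    and z: "l z \<noteq> 0"
  shows "finite_entropy p l" "mass p l = 1" "nehari_functional p E W l \<le> m"
proof -
  let ?w = "\<lambda>n x. \<bar>v n x\<bar> powr p" and ?wl = "\<lambda>x. \<bar>l x\<bar> powr p"
  have vs: "?w n summable_on UNIV" for n using v(1) by (simp add: finite_entropy_def)
  have w_lim: "((\<lambda>n. ?w n x) \<longlongrightarrow> ?wl x) F" for x by (intro tendsto_abs_powr l)
  have mass_K: "(\<Sum>x\<in>K. ?w n x) \<le> 1" if "finite K" for n K
    using sum_le_infsum[OF vs[of n] _ that] v(2)[of n] by (simp add: mass_def)
  have "(\<Sum>x\<in>K. ?wl x) \<le> 1" if "finite K" for K
    using mass_K[OF that]
    by (intro tendsto_upperbound[OF tendsto_sum[OF w_lim] always_eventually F]) auto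
  from nonneg_infsum_le[OF powr_ge_zero this]
  have ls: "?wl summable_on UNIV" and l_le: "mass p l \<le> 1" by (auto simp: mass_def)
  have wl_le: "?wl x \<le> 1" for x
    using sum_le_infsum[OF ls, of "{x}"] l_le by (simp add: mass_def)
  have W_ge: "W x \<ge> -1" for x
    using V(1) by (intro tendsto_lowerbound[OF W(1) always_eventually F]) auto

  \<comment> \<open>Adding the mass makes the density nonnegative, because \<open>W \<ge> -1\<close> and the entropy is nonpositive.\<close>
  define f where "f x = nehari_density p E W l x + ?wl x" for x
  have f0: "f x \<ge> 0" for x
    using nehari_density_ge[of W x l, OF W_ge wl_le] by (simp add: f_def)
  have "sum f K \<le> m + 1" if K: "finite K" for K
  proof -
    have "(\<Sum>x\<in>K. nehari_density p E (V n) (v n) x + ?w n x) \<le> nehari_functional p E (V n) (v n) + 1" for n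
    proof -
      have "(\<Sum>x\<in>K. nehari_density p E (V n) (v n) x + ?w n x)
          \<le> (\<Sum>\<^sub>\<infinity>x. nehari_density p E (V n) (v n) x + ?w n x)"
      proof (rule sum_le_infsum[OF _ _ K])
        show "(\<lambda>x. nehari_density p E (V n) (v n) x + ?w n x) summable_on UNIV"
          using vs v V by (intro summable_on_add nehari_density_summable) auto
        show "nehari_density p E (V n) (v n) x + ?w n x \<ge> 0" for x
          using nehari_density_ge[of "V n" x "v n", OF V(1) powr_le_1[OF vs v(2)]] by simp
      qed
      also have "\<dots> = nehari_functional p E (V n) (v n) + 1"
        using v(2)[of n] unfolding nehari_functional_def mass_def
        by (subst infsum_add) (auto intro!: vs nehari_density_summable[OF v(1) V(2)])
      finally show ?thesis .
    qed
    then show ?thesis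
      unfolding f_def
      by (intro tendsto_le[OF F tendsto_add[OF lim tendsto_const[of 1]]
            tendsto_sum[OF tendsto_add[OF tendsto_nehari_density[where V = V and W = W, OF l W(1)] w_lim]]] always_eventually) auto
  qed
  from nonneg_infsum_le[OF f0 this]
  have fs: "f summable_on UNIV" and f_le: "infsum f UNIV \<le> m + 1" by auto
  have "(\<lambda>x. ?wl x * ln (?wl x)) summable_on UNIV"
  proof (rule summable_on_comparison_real[OF fs])
    fix x
    have "(W x + 1) * ?wl x \<ge> 0" using W_ge[of x] by simp
    moreover have "grad_norm p E l x powr p \<ge> 0" by simp
    moreover have "?wl x * ln (?wl x) \<le> 0" using wl_le by (intro mult_ln_nonpos) auto
    ultimately show "\<bar>?wl x * ln (?wl x)\<bar> \<le> f x"
      unfolding f_def nehari_density_def distrib_right by linarith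
  qed
  with ls show fl: "finite_entropy p l" by (simp add: finite_entropy_def)

  show mass1: "mass p l = 1"
  proof (rule ccontr)
    assume "mass p l \<noteq> 1"
    with l_le have lt: "mass p l < 1" by simp
    \<comment> \<open>A lower bound for \<open>b (1 - b)\<close> whenever \<open>b\<close> is the mass of \<open>l\<close> on a finite set containing \<open>z\<close>.\<close>
    define e where "e = ?wl z * (1 - mass p l)"
    have "e > 0" using z lt by (simp add: e_def)
    then obtain K where K: "finite K" "z \<in> K" "(\<Sum>x\<in>K \<union> E `` K. boundary_mass p E K l x) < e"
      using boundary_mass_small[OF ls] by blast
    define a where "a n = (\<Sum>x\<in>K. ?w n x)" for n
    define b where "b = (\<Sum>x\<in>K. ?wl x)"
    have split: "m + a n * (1 - a n)
        \<le> nehari_functional p E (V n) (v n) + (\<Sum>x\<in>K \<union> E `` K. boundary_mass p E K (v n) x)" for n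
    proof -
      have m1: "mass p (cutoff K (v n)) = a n"
        using mass_cutoff_finite[OF K(1)] by (simp add: a_def)
      have m2: "mass p (cutoff (- K) (v n)) = 1 - a n"
        using mass_cutoff_Compl[OF vs[of n], of K] m1 v(2)[of n] by simp
      have a: "0 \<le> a n" "a n \<le> 1"
        using mass_K[OF K(1)] by (auto simp: a_def intro: sum_nonneg)
      have ge: "m * mass p (cutoff A (v n)) - mass p (cutoff A (v n)) * ln (mass p (cutoff A (v n)))
          \<le> nehari_functional p E (V n) (cutoff A (v n))" for A
        by (rule nehari_functional_ge[OF V(2) m finite_entropy_cutoff[OF v(1)]])
      have "m + a n * (1 - a n) \<le> m + a n * (1 - a n) + (1 - a n) * a n"
        using a by simp
      also have "\<dots> \<le> m - a n * ln (a n) - (1 - a n) * ln (1 - a n)"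
      proof -
        have add: "m + s + t \<le> m - s' - t'" if "s \<le> - s'" "t \<le> - t'" for s t s' t' :: real
          using that by simp
        show ?thesis
          by (rule add) (use entropy_ge_quadratic[of "a n"] entropy_ge_quadratic[of "1 - a n"] a in auto)
      qed
      also have "\<dots> \<le> nehari_functional p E (V n) (cutoff K (v n))
                      + nehari_functional p E (V n) (cutoff (- K) (v n))"
        using ge[of K] ge[of "- K"] unfolding m1 m2 by (simp add: algebra_simps)
      also have "\<dots> \<le> nehari_functional p E (V n) (v n)
                      + (\<Sum>x\<in>K \<union> E `` K. boundary_mass p E K (v n) x)"
        by (rule nehari_functional_cutoff[OF K(1) v(1) V(2)])
      finally show ?thesis .
    qed
    have a_lim: "(a \<longlongrightarrow> b) F"
      unfolding a_def[abs_def] b_def by (intro tendsto_sum w_lim)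
    have "((\<lambda>n. boundary_mass p E K (v n) x) \<longlongrightarrow> boundary_mass p E K l x) F" for x
      unfolding boundary_mass_def
    proof (intro tendsto_divide tendsto_sum tendsto_const)
      fix y
      show "((\<lambda>n. if (x \<in> K) \<noteq> (y \<in> K) then ?w n x + ?w n y else 0)
          \<longlongrightarrow> (if (x \<in> K) \<noteq> (y \<in> K) then ?wl x + ?wl y else 0)) F"
        by (cases "(x \<in> K) \<noteq> (y \<in> K)") (auto intro!: tendsto_add w_lim)
    qed simp
    then have "((\<lambda>n. nehari_functional p E (V n) (v n)
          + (\<Sum>x\<in>K \<union> E `` K. boundary_mass p E K (v n) x))
        \<longlongrightarrow> m + (\<Sum>x\<in>K \<union> E `` K. boundary_mass p E K l x)) F"
      by (intro tendsto_add lim tendsto_sum)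
    moreover have "((\<lambda>n. m + a n * (1 - a n)) \<longlongrightarrow> m + b * (1 - b)) F"
      by (intro tendsto_intros a_lim)
    ultimately have "m + b * (1 - b) \<le> m + (\<Sum>x\<in>K \<union> E `` K. boundary_mass p E K l x)"
      using split by (intro tendsto_le[OF F]) auto
    moreover have "e \<le> b * (1 - b)"
    proof -
      have "?wl z \<le> b" unfolding b_def using K by (intro member_le_sum) auto
      moreover have "0 \<le> b" unfolding b_def by (simp add: sum_nonneg)
      moreover have "b \<le> mass p l"
        unfolding b_def mass_def using K ls by (intro sum_le_infsum) auto
      ultimately show ?thesis unfolding e_def using lt by (intro mult_mono) auto
    qed
    ultimately show False using K(3) by simp
  qed

  have "infsum f UNIV = nehari_functional p E W l + 1"
    using mass1 unfolding f_def nehari_functional_def mass_def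
    by (subst infsum_add) (auto intro!: ls nehari_density_summable[OF fl W(2)])
  with f_le show "nehari_functional p E W l \<le> m" by simp
qed

lemma finite_support_finite_entropy:
  fixes u :: "'v \<Rightarrow> real"
  assumes "finite {x. u x \<noteq> 0}"
  shows "finite_entropy p u"
proof -
  have "f summable_on UNIV" if "\<And>x. u x = 0 \<Longrightarrow> f x = 0" for f :: "'v \<Rightarrow> real"
    using has_sum_finite_neutralI[OF assms subset_UNIV, of f] that has_sum_imp_summable by blast
  then show ?thesis by (simp add: finite_entropy_def)
qed

section \<open>Existence of a minimiser on the sphere\<close>

text \<open>
  Take a minimising sequence \<open>u n\<close> with a vertex \<open>x n\<close> of concentration, and automorphisms \<open>g n\<close> carrying a
  fixed vertex \<open>z0\<close> to \<open>x n\<close>. If \<open>x n\<close> returns to a bounded set, \<open>u n\<close> itself has a nonzero limit. Otherwise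
  the translates \<open>u n \<circ> g n\<close> have one, and they minimise for the potentials \<open>V \<circ> g n\<close>, which converge to the
  invariant potential \<open>Vp\<close>. Because \<open>V \<le> Vp\<close>, the limit then minimises for \<open>V\<close> as well.
\<close>
lemma minimizer_exists:
  assumes conn: "graph_connected E"
    and aut: "\<And>g. g \<in> G \<Longrightarrow> bij g" "\<And>g x y. g \<in> G \<Longrightarrow> (g x, g y) \<in> E \<longleftrightarrow> (x, y) \<in> E"
    and Z: "finite Z" "\<And>x. \<exists>z\<in>Z. \<exists>g\<in>G. g z = x"
    and V: "\<And>x. V x \<ge> -1" "\<And>x. \<bar>V x\<bar> \<le> B"
    and Vp: "\<And>g x. g \<in> G \<Longrightarrow> Vp (g x) = Vp x" "\<And>x. V x \<le> Vp x" "\<And>x. \<bar>Vp x\<bar> \<le> B"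
    and inf: "((\<lambda>x. \<bar>V x - Vp x\<bar>) \<longlongrightarrow> 0) (at_graph_infinity E x0)"
  shows "\<exists>v. finite_entropy p v \<and> mass p v = 1 \<and> (\<forall>x. v x \<ge> 0) \<and>
    (\<forall>u. finite_entropy p u \<longrightarrow> mass p u = 1 \<longrightarrow>
       nehari_functional p E V v \<le> nehari_functional p E V u)"
proof -
  let ?N = "nehari_functional p E"
  define S where "S = {?N V u | u. finite_entropy p u \<and> mass p u = 1}"
  define m where "m = Inf S"
  have "finite_entropy p (cutoff {x0} (\<lambda>_. 1))"
    by (rule finite_support_finite_entropy) (simp add: cutoff_def)
  moreover have "mass p (cutoff {x0} (\<lambda>_. 1)) = 1"
    by (subst mass_cutoff_finite) auto
  ultimately have ne: "S \<noteq> {}" unfolding S_def by blast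
  have bdd: "bdd_below S"
    unfolding S_def using nehari_functional_ge_minus1[OF _ _ V] by (intro bdd_belowI[of _ "-1"]) auto
  have m: "m \<le> ?N V u" if "finite_entropy p u" "mass p u = 1" for u
    unfolding m_def using that by (intro cInf_lower bdd) (auto simp: S_def)

  have "\<exists>u. finite_entropy p u \<and> mass p u = 1 \<and> (\<forall>x. u x \<ge> 0) \<and> ?N V u < m + 1 / Suc n" for n
  proof -
    have "Inf S < m + 1 / Suc n" by (simp add: m_def)
    then obtain s where "s \<in> S" "s < m + 1 / Suc n" using cInf_lessD[OF ne] by blast
    then obtain u where "finite_entropy p u" "mass p u = 1" "?N V u < m + 1 / Suc n"
      unfolding S_def by blast
    with nehari_functional_abs[of u V B, OF _ V(2)] show ?thesis
      by (intro exI[of _ "\<lambda>x. \<bar>u x\<bar>"]) auto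
  qed
  then obtain u where u: "\<And>n. finite_entropy p (u n)" "\<And>n. mass p (u n) = 1" "\<And>n x. u n x \<ge> 0"
    "\<And>n. ?N V (u n) < m + 1 / Suc n" by metis
  have u_lim: "(\<lambda>n. ?N V (u n)) \<longlonglongrightarrow> m"
  proof (rule tendsto_sandwich[OF always_eventually always_eventually tendsto_const])
    show "\<forall>n. m \<le> ?N V (u n)" using m u by blast
    show "\<forall>n. ?N V (u n) \<le> m + 1 / Suc n" using u(4) less_imp_le by blast
    show "(\<lambda>n. m + 1 / Suc n) \<longlonglongrightarrow> m"
      using tendsto_add[OF tendsto_const[of m] LIMSEQ_inverse_real_of_nat] by (simp add: inverse_eq_divide)
  qed

  \<comment> \<open>The threshold of \<open>entropy_concentration\<close> at the level \<open>m + 1\<close>.\<close>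
  define \<delta> where "\<delta> = exp (- (m + 1 + 2))"
  have "\<exists>x. \<bar>u n x\<bar> powr p \<ge> \<delta>" for n
  proof -
    have "1 / real (Suc n) \<le> 1" by simp
    with u(4)[of n] have "?N V (u n) \<le> m + 1" by linarith
    from entropy_concentration[OF u(1,2) V this] show ?thesis by (simp add: \<delta>_def)
  qed
  then obtain x where x: "\<And>n. \<bar>u n (x n)\<bar> powr p \<ge> \<delta>" by metis
  have "\<exists>g. \<forall>n. g n \<in> G \<and> (\<exists>z\<in>Z. g n z = x n)"
    by (rule choice) (use Z(2) in blast)
  then obtain g where g: "\<And>n. g n \<in> G" "\<And>n. \<exists>z\<in>Z. g n z = x n" by blast
  have "\<exists>z. \<forall>n. z n \<in> Z \<and> g n (z n) = x n"
    by (rule choice) (use g(2) in blast)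
  then obtain z where zg: "\<And>n. z n \<in> Z" "\<And>n. g n \<in> G" "\<And>n. g n (z n) = x n"
    using g(1) by blast
  have u01: "u n y \<in> {0..1}" for n y
  proof -
    have "(u n y) powr p \<le> 1"
      using powr_le_1[of "u n" y] u by (simp add: finite_entropy_def)
    then have "\<not> u n y > 1" using p_gt_1 gr_one_powr[of "u n y" p] by linarith
    then show ?thesis using u(3) by simp
  qed
  have "\<exists>\<^sub>F n in sequentially. z n \<in> Z" by (simp add: zg(1))
  then obtain z0 F1 where F1: "F1 \<le> sequentially" "F1 \<noteq> bot" "\<forall>\<^sub>F n in F1. z n = z0"
    using constant_on_finer_filter[OF _ Z(1)] by metis

  have "\<exists>l. finite_entropy p l \<and> mass p l = 1 \<and> (\<forall>x. l x \<ge> 0) \<and> ?N V l \<le> m"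
  proof (cases "\<exists>R. \<exists>\<^sub>F n in F1. graph_dist E (g n z0) x0 \<le> R")
    case True
    then obtain R where "\<exists>\<^sub>F n in F1. g n z0 \<in> {y. graph_dist E y x0 \<le> R}" by auto
    then obtain y F2 where F2: "F2 \<le> F1" "F2 \<noteq> bot" "\<forall>\<^sub>F n in F2. g n z0 = y"
      using constant_on_finer_filter[OF _ finite_graph_ball[OF conn sym_E finite_nbrs]] by metis
    obtain F l where F: "F \<le> F2" "F \<noteq> bot" "\<And>x. ((\<lambda>n. u n x) \<longlongrightarrow> l x) F"
      using pointwise_convergent_finer_filter[OF F2(2), of u] u01 by blast
    have FF: "F \<le> sequentially" "F \<le> F1" using F F2 F1 by auto
    have "\<forall>\<^sub>F n in F. \<delta> \<le> \<bar>u n y\<bar> powr p"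
      using filter_leD[OF FF(2) F1(3)] filter_leD[OF F(1) F2(3)]
      by eventually_elim (use x zg in metis)
    then have "\<delta> \<le> \<bar>l y\<bar> powr p"
      by (rule tendsto_lowerbound[OF tendsto_abs_powr[OF F(3)] _ F(2)])
    then have "l y \<noteq> 0" by (auto simp: \<delta>_def not_le[symmetric])
    from minimizing_filter_compact[where v = u and V = "\<lambda>_. V" and W = V and B = B, OF F(2) u(1,2) V m
        tendsto_mono[OF FF(1) u_lim] F(3) tendsto_const V(2) this]
    have "finite_entropy p l" "mass p l = 1" "?N V l \<le> m" by auto
    moreover have "l x \<ge> 0" for x
      using u(3) by (intro tendsto_lowerbound[OF F(3) _ F(2)] always_eventually) auto
    ultimately show ?thesis by blast
  next
    case False
    then have far: "\<forall>\<^sub>F n in F1. \<not> graph_dist E (g n z0) x0 \<le> R" for R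
      by (simp add: frequently_def)
    define v where "v n y = u n (g n y)" for n y
    obtain F l where F: "F \<le> F1" "F \<noteq> bot" "\<And>x. ((\<lambda>n. v n x) \<longlongrightarrow> l x) F"
      using pointwise_convergent_finer_filter[OF F1(2), of v] u01 unfolding v_def by blast
    note FF = order_trans[OF F(1) F1(1)]
    note tr = nehari_functional_automorphism[OF aut, OF zg(2) zg(2)]
    have v: "finite_entropy p (v n)" "mass p (v n) = 1" "?N (\<lambda>x. V (g n x)) (v n) = ?N V (u n)" for n
      unfolding v_def tr using u by auto
    have "\<forall>\<^sub>F n in F. \<delta> \<le> \<bar>v n z0\<bar> powr p"
      using filter_leD[OF F(1) F1(3)] unfolding v_def
      by eventually_elim (use x zg in metis)
    then have "\<delta> \<le> \<bar>l z0\<bar> powr p"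
      by (rule tendsto_lowerbound[OF tendsto_abs_powr[OF F(3)] _ F(2)])
    then have l0: "l z0 \<noteq> 0" by (auto simp: \<delta>_def not_le[symmetric])
    have V_lim: "((\<lambda>n. V (g n y)) \<longlongrightarrow> Vp y) F" for y
    proof -
      have "filterlim (\<lambda>n. g n y) (at_graph_infinity E x0) F1"
        using far by (intro automorphisms_to_infinity[where z = z0, OF conn]) (auto simp: aut(2)[OF zg(2)])
      then have "filterlim (\<lambda>n. g n y) (at_graph_infinity E x0) F"
        by (rule filterlim_mono[OF _ order_refl F(1)])
      from filterlim_compose[OF inf this]
      have "((\<lambda>n. V (g n y) - Vp y) \<longlongrightarrow> 0) F"
        by (simp add: Vp(1)[OF zg(2)] tendsto_rabs_zero_iff)
      then show ?thesis by (simp add: LIM_zero_iff)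
    qed
    have m': "m \<le> ?N (\<lambda>x. V (g n x)) w" if w: "finite_entropy p w" "mass p w = 1" for n w
    proof -
      define w' where "w' y = w (inv_into UNIV (g n) y)" for y
      have "w = (\<lambda>y. w' (g n y))"
        using aut(1)[OF zg(2)] by (auto simp: w'_def fun_eq_iff bij_def)
      then show ?thesis using m[of w'] w by (metis tr)
    qed
    from minimizing_filter_compact[where v = v and V = "\<lambda>n x. V (g n x)" and W = Vp and B = B, OF F(2) v(1,2) V(1) V(2) m'
        _ F(3) V_lim Vp(3) l0]
    have l: "finite_entropy p l" "mass p l = 1" "?N Vp l \<le> m"
      using tendsto_mono[OF FF u_lim] by (auto simp: v(3))
    have "?N V l \<le> ?N Vp l"
      unfolding nehari_functional_def using l Vp V
      by (intro infsum_mono nehari_density_summable)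
        (auto simp: nehari_density_def mult_right_mono)
    moreover have "l x \<ge> 0" for x
      using u(3) by (intro tendsto_lowerbound[OF F(3) _ F(2)] always_eventually) (auto simp: v_def)
    ultimately show ?thesis using l by force
  qed
  then show ?thesis using m order_trans by blast
qed

section \<open>The Euler--Lagrange equation and positivity\<close>

text \<open>
  By scaling, \<open>u \<mapsto> N u - m M u + M u ln (M u)\<close> is nonnegative on all admissible functions
  and vanishes at \<open>v\<close>, so the constraint disappears. Varying \<open>v\<close> at a single vertex changes finitely many
  terms, and the derivative of the resulting real function vanishes. Each edge at \<open>x\<close> is seen from
  both of its ends, which cancels the factor \<open>1 / 2\<close> of the gradient.
\<close>
lemma euler_lagrange:
  assumes v: "finite_entropy p v" "mass p v = 1" and V: "\<And>x. \<bar>V x\<bar> \<le> B"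
    and min: "\<And>u. finite_entropy p u \<Longrightarrow> mass p u = 1 \<Longrightarrow>
       nehari_functional p E V v \<le> nehari_functional p E V u"
  shows "- p_Laplacian p E v x + V x * \<bar>v x\<bar> powr (p - 2) * v x
       = \<bar>v x\<bar> powr (p - 2) * v x * (ln (\<bar>v x\<bar> powr p) + nehari_functional p E V v)"
proof -
  define m where "m = nehari_functional p E V v"
  define \<phi> where "\<phi> t = \<bar>t\<bar> powr (p - 2) * t" for t :: real
  define \<delta> :: "'v \<Rightarrow> real" where "\<delta> y = of_bool (y = x)" for y
  define u where "u s y = v y + s * \<delta> y" for s y
  define S where "S = insert x (E `` {x})"
  have S: "finite S" using finite_nbrs by (simp add: S_def)
  have u0: "u 0 = v" by (simp add: u_def fun_eq_iff)
  have u_off: "u s y = v y" if "y \<noteq> x" for s y using that by (simp add: u_def \<delta>_def)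

  have fe: "finite_entropy p (u s)" for s
  proof -
    have "(\<lambda>y. \<bar>u s y\<bar> powr p) summable_on UNIV"
      by (rule summable_on_finite_change(1)[where S = "{x}" and f = "\<lambda>y. \<bar>v y\<bar> powr p"])
        (use v u_off in \<open>auto simp: finite_entropy_def\<close>)
    moreover have "(\<lambda>y. \<bar>u s y\<bar> powr p * ln (\<bar>u s y\<bar> powr p)) summable_on UNIV"
      by (rule summable_on_finite_change(1)[where S = "{x}" and f = "\<lambda>y. \<bar>v y\<bar> powr p * ln (\<bar>v y\<bar> powr p)"])
        (use v u_off in \<open>auto simp: finite_entropy_def\<close>)
    ultimately show ?thesis by (simp add: finite_entropy_def)
  qed
  have M: "mass p (u s) = 1 + (\<bar>u s x\<bar> powr p - \<bar>v x\<bar> powr p)" for s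
    unfolding v(2)[symmetric] mass_def
    by (subst summable_on_finite_change(2)[where S = "{x}" and f = "\<lambda>y. \<bar>v y\<bar> powr p"])
      (use v u_off in \<open>auto simp: finite_entropy_def\<close>)
  have N: "nehari_functional p E V (u s)
      = m + (\<Sum>z\<in>S. nehari_density p E V (u s) z - nehari_density p E V v z)" for s
    unfolding m_def nehari_functional_def
  proof (rule summable_on_finite_change(2)[OF nehari_density_summable[OF v(1) V] S])
    fix z assume z: "z \<notin> S"
    then have "y \<noteq> x" if "y \<in> E `` {z}" for y
      using that sym_E by (auto simp: S_def dest: symD)
    with z u_off[of z s] have "grad_norm p E (u s) z = grad_norm p E v z"
      unfolding grad_norm_def by (auto simp: S_def u_off intro!: arg_cong2[of _ _ _ _ "(powr)"] sum.cong)
    with z u_off[of z s] show "nehari_density p E V (u s) z = nehari_density p E V v z"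
      by (auto simp: nehari_density_def S_def)
  qed

  define h where "h s = nehari_functional p E V (u s) - (m * mass p (u s) - mass p (u s) * ln (mass p (u s)))" for s
  have h_min: "h 0 \<le> h s" for s
    using nehari_functional_ge[OF V min fe, of s] v
    by (simp add: h_def u0 flip: m_def)

  note d_pow = has_real_derivative_abs_powr[OF p_gt_1]
  note d_ln = has_real_derivative_abs_powr_ln[OF p_gt_1]
  have du: "((\<lambda>s. u s y) has_real_derivative \<delta> y) (at 0)" for y
    unfolding u_def by (auto intro!: derivative_eq_intros)
  have d1: "((\<lambda>s. \<bar>u s y - u s z\<bar> powr p) has_real_derivative p * \<phi> (v y - v z) * (\<delta> y - \<delta> z)) (at 0)" for y z
    using DERIV_chain2[where f = "\<lambda>t. \<bar>t\<bar> powr p" and g = "\<lambda>s. u s y - u s z", OF d_pow DERIV_diff[OF du du]]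
    by (simp add: u0 \<phi>_def)
  have d2: "((\<lambda>s. \<bar>u s z\<bar> powr p) has_real_derivative p * \<phi> (v z) * \<delta> z) (at 0)" for z
    using DERIV_chain2[where f = "\<lambda>t. \<bar>t\<bar> powr p" and g = "\<lambda>s. u s z", OF d_pow du]
    by (simp add: u0 \<phi>_def)
  have d3: "((\<lambda>s. \<bar>u s z\<bar> powr p * ln (\<bar>u s z\<bar> powr p)) has_real_derivative
      p * \<phi> (v z) * (ln (\<bar>v z\<bar> powr p) + 1) * \<delta> z) (at 0)" for z
    using DERIV_chain2[where f = "\<lambda>t. \<bar>t\<bar> powr p * ln (\<bar>t\<bar> powr p)" and g = "\<lambda>s. u s z", OF d_ln du]
    by (simp add: u0 \<phi>_def del: ln_powr)
  define G where "G z = 1 / 2 * (\<Sum>y\<in>E `` {z}. p * \<phi> (v y - v z) * (\<delta> y - \<delta> z))" for z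
  define P where "P z = p * \<phi> (v z) * (V z - (ln (\<bar>v z\<bar> powr p) + 1))" for z
  have d4: "((\<lambda>s. nehari_density p E V (u s) z - nehari_density p E V v z) has_real_derivative
      G z + P z * \<delta> z) (at 0)" for z
  proof -
    have "((\<lambda>s. 1 / 2 * (\<Sum>y\<in>E `` {z}. \<bar>u s y - u s z\<bar> powr p) + V z * \<bar>u s z\<bar> powr p
        - \<bar>u s z\<bar> powr p * ln (\<bar>u s z\<bar> powr p) - nehari_density p E V v z) has_real_derivative
      G z + V z * (p * \<phi> (v z) * \<delta> z) - p * \<phi> (v z) * (ln (\<bar>v z\<bar> powr p) + 1) * \<delta> z - 0) (at 0)"
      unfolding G_def
      by (intro DERIV_diff DERIV_add DERIV_cmult DERIV_sum d1 d2 d3 DERIV_const)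
    moreover have "V z * (p * \<phi> (v z) * \<delta> z) - p * \<phi> (v z) * (ln (\<bar>v z\<bar> powr p) + 1) * \<delta> z = P z * \<delta> z"
      unfolding P_def by (simp only: right_diff_distrib left_diff_distrib mult_ac)
    ultimately show ?thesis unfolding nehari_density_def[of p E V "u _"] grad_norm_powr
      by (simp del: ln_powr add: add_diff_eq[symmetric])
  qed
  have dM: "((\<lambda>s. mass p (u s)) has_real_derivative p * \<phi> (v x)) (at 0)"
    unfolding M using DERIV_add[OF DERIV_const DERIV_diff[OF d2[of x] DERIV_const]]
    by (simp add: \<delta>_def)
  have dMln: "((\<lambda>s. mass p (u s) * ln (mass p (u s))) has_real_derivative p * \<phi> (v x)) (at 0)"
  proof -
    have "((\<lambda>w::real. w * ln w) has_real_derivative 1) (at (mass p (u 0)))"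
      unfolding u0 v(2) by (auto intro!: derivative_eq_intros)
    from DERIV_chain2[OF this dM] show ?thesis by simp
  qed
  have "(h has_real_derivative (0 + (\<Sum>z\<in>S. G z + P z * \<delta> z)) - (m * (p * \<phi> (v x)) - p * \<phi> (v x))) (at 0)"
    unfolding h_def[abs_def] N
    by (intro DERIV_diff DERIV_add DERIV_const DERIV_sum d4 DERIV_cmult dM dMln)
  from DERIV_local_min[OF this zero_less_one] h_min
  have crit: "(\<Sum>z\<in>S. G z + P z * \<delta> z) = m * (p * \<phi> (v x)) - p * \<phi> (v x)" by simp

  have \<phi>0: "\<phi> 0 = 0" and \<phi>_odd: "\<phi> (a - b) = - \<phi> (b - a)" for a b
    by (auto simp: \<phi>_def abs_minus_commute minus_mult_right)
  have Lap: "p_Laplacian p E v x = (\<Sum>y\<in>E `` {x}. \<phi> (v y - v x))"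
    by (simp add: p_Laplacian_def \<phi>_def)
  \<comment> \<open>A loop at \<open>x\<close> contributes \<open>\<phi> 0 = 0\<close> on both sides.\<close>
  have Gx: "G x = - (p / 2) * p_Laplacian p E v x"
    unfolding G_def Lap sum_distrib_left by (intro sum.cong) (auto simp: \<delta>_def \<phi>0)
  have Gz: "G z = - (p / 2) * \<phi> (v z - v x)" if z: "z \<in> E `` {x} - {x}" for z
  proof -
    have xz: "x \<in> E `` {z}" using z sym_E by (auto dest: symD)
    \<comment> \<open>Seen from a neighbour, only the edge back to \<open>x\<close> varies.\<close>
    have "(\<Sum>y\<in>E `` {z}. p * \<phi> (v y - v z) * (\<delta> y - \<delta> z)) = (\<Sum>y\<in>{x}. p * \<phi> (v y - v z) * (\<delta> y - \<delta> z))"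
      using z xz finite_nbrs by (intro sum.mono_neutral_right) (auto simp: \<delta>_def)
    then show ?thesis using z \<phi>_odd[of "v x" "v z"] by (simp add: G_def \<delta>_def)
  qed
  have "(\<Sum>z\<in>S. G z) = G x + (\<Sum>z\<in>E `` {x} - {x}. G z)"
    unfolding S_def using finite_nbrs by (subst sum.insert_remove) auto
  also have "(\<Sum>z\<in>E `` {x} - {x}. G z) = - (p / 2) * (\<Sum>z\<in>E `` {x} - {x}. \<phi> (v z - v x))"
    unfolding sum_distrib_left by (intro sum.cong Gz) auto
  also have "(\<Sum>z\<in>E `` {x} - {x}. \<phi> (v z - v x)) = p_Laplacian p E v x"
    unfolding Lap using finite_nbrs \<phi>0 by (intro sum.mono_neutral_left) auto
  finally have sumG: "(\<Sum>z\<in>S. G z) = - p * p_Laplacian p E v x" unfolding Gx by simp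
  have "(\<Sum>z\<in>S. P z * \<delta> z) = (\<Sum>z\<in>{x}. P z * \<delta> z)"
    using S by (intro sum.mono_neutral_right) (auto simp: S_def \<delta>_def)
  then have sumP: "(\<Sum>z\<in>S. P z * \<delta> z) = P x" by (simp add: \<delta>_def)
  from crit have "p * (- p_Laplacian p E v x + V x * \<phi> (v x) - \<phi> (v x) * (ln (\<bar>v x\<bar> powr p) + m)) = 0"
    unfolding sum.distrib sumG sumP unfolding P_def by (simp add: algebra_simps del: ln_powr)
  then show ?thesis using p_gt_1 unfolding \<phi>_def m_def by (simp add: mult.assoc del: ln_powr)
qed

text \<open>
  Where \<open>v\<close> vanishes, its Laplacian is a sum of nonnegative terms over the
  neighbours, so \<open>v\<close> vanishes at the neighbours too, and connectedness spreads the zero everywhere.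
\<close>
lemma strong_maximum_principle:
  assumes conn: "graph_connected E" and v: "\<And>x. v x \<ge> 0" "v \<noteq> (\<lambda>_. 0)"
    and eq: "\<And>x. v x = 0 \<Longrightarrow> p_Laplacian p E v x = 0"
  shows "v x > 0"
proof (rule ccontr)
  assume "\<not> v x > 0"
  then have x: "v x = 0" using v(1)[of x] by simp
  have step: "v z = 0" if y: "v y = 0" and yz: "(y, z) \<in> E" for y z
  proof -
    have "(\<Sum>z\<in>E `` {y}. \<bar>v z\<bar> powr (p - 2) * v z) = 0"
      using eq[OF y] y by (simp add: p_Laplacian_def)
    then have "\<bar>v z\<bar> powr (p - 2) * v z = 0"
      using sum_nonneg_eq_0_iff[OF finite_nbrs, of y "\<lambda>z. \<bar>v z\<bar> powr (p - 2) * v z"] v(1) yz by auto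
    then show ?thesis by auto
  qed
  have "v y = 0" for y
  proof -
    have "(x, y) \<in> E\<^sup>*" using conn by (simp add: graph_connected_def)
    then show ?thesis by (induction rule: rtrancl_induct) (use x step in auto)
  qed
  with v(2) show False by auto
qed

section \<open>Translation to the Sobolev space and the energy\<close>

lemma W1p_norm_powr:
  assumes w: "(\<lambda>x. \<bar>w x\<bar> powr p) summable_on UNIV"
  shows "W1p_norm p E w powr p = (\<Sum>\<^sub>\<infinity>x. grad_norm p E w x powr p) + mass p w"
proof -
  have "W1p_norm p E w = ((\<Sum>\<^sub>\<infinity>x. grad_norm p E w x powr p) + mass p w) powr (1 / p)"
    unfolding W1p_norm_def mass_def
    using gradient_le_mass(1)[OF w] w
    by (subst integral_count_space_eq_infsum(2)) (auto simp: infsum_add intro!: summable_on_add)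
  moreover have "(\<Sum>\<^sub>\<infinity>x. grad_norm p E w x powr p) + mass p w \<ge> 0"
    unfolding mass_def by (intro add_nonneg_nonneg infsum_nonneg) auto
  ultimately show ?thesis using p_gt_1 by (simp add: powr_powr)
qed

lemma mass_le_W1p_norm:
  assumes w: "(\<lambda>x. \<bar>w x\<bar> powr p) summable_on UNIV"
  shows "mass p w \<le> W1p_norm p E w powr p"
  unfolding W1p_norm_powr[OF w] by (simp add: infsum_nonneg)

lemma W1p_norm_le_mass:
  assumes w: "(\<lambda>x. \<bar>w x\<bar> powr p) summable_on UNIV"
  shows "W1p_norm p E w powr p \<le> (2 powr p * D + 1) * mass p w"
  unfolding W1p_norm_powr[OF w] using gradient_le_mass(2)[OF w] by (simp add: distrib_right)

lemma finite_support_summable: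
  fixes w :: "'v \<Rightarrow> real"
  assumes "finite {x. w x \<noteq> 0}"
  shows "(\<lambda>x. \<bar>w x\<bar> powr p) summable_on UNIV"
  using finite_support_finite_entropy[OF assms] by (simp add: finite_entropy_def)

text \<open>
  A Cauchy sequence is bounded in \<open>\<ell>\<^sup>p\<close>, and finite partial sums pass to the pointwise limit. The
  crude inequality \<open>abs_diff_powr_le\<close> replaces the triangle inequality of the norm.
\<close>
lemma W1p_imp_summable:
  assumes "u \<in> W1p p E"
  shows "(\<lambda>x. \<bar>u x\<bar> powr p) summable_on UNIV"
proof -
  obtain \<phi> where fin: "\<And>n. finite {x. \<phi> n x \<noteq> 0}"
    and cauchy: "\<And>\<epsilon>. \<epsilon> > 0 \<Longrightarrow> \<exists>N. \<forall>m\<ge>N. \<forall>n\<ge>N. W1p_norm p E (\<lambda>x. \<phi> m x - \<phi> n x) < \<epsilon>"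
    and lim: "\<And>x. (\<lambda>n. \<phi> n x) \<longlonglongrightarrow> u x"
    using assms unfolding W1p_def by blast
  obtain N where N: "\<And>n. n \<ge> N \<Longrightarrow> W1p_norm p E (\<lambda>x. \<phi> n x - \<phi> N x) < 1"
    using cauchy[of 1] by auto
  have bound: "(\<Sum>x\<in>K. \<bar>u x\<bar> powr p) \<le> 2 powr p * (1 + mass p (\<phi> N))" if K: "finite K" for K
  proof (rule tendsto_upperbound)
    show "(\<lambda>n. \<Sum>x\<in>K. \<bar>\<phi> n x\<bar> powr p) \<longlonglongrightarrow> (\<Sum>x\<in>K. \<bar>u x\<bar> powr p)"
      by (intro tendsto_sum tendsto_abs_powr lim)
    have "(\<Sum>x\<in>K. \<bar>\<phi> n x\<bar> powr p) \<le> 2 powr p * (1 + mass p (\<phi> N))" if n: "n \<ge> N" for n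
    proof -
      let ?w = "\<lambda>x. \<phi> n x - \<phi> N x"
      have "finite {x. ?w x \<noteq> 0}"
        by (rule finite_subset[OF _ finite_UnI[OF fin[of n] fin[of N]]]) auto
      note ws = finite_support_summable[OF this]
      have "(\<Sum>x\<in>K. \<bar>?w x\<bar> powr p) \<le> mass p ?w"
        unfolding mass_def by (rule sum_le_infsum[OF ws _ K]) auto
      also have "\<dots> \<le> W1p_norm p E ?w powr p" by (rule mass_le_W1p_norm[OF ws])
      also have "\<dots> \<le> 1"
        using N[OF n] p_gt_1 powr_mono2[of p "W1p_norm p E ?w" 1] by (simp add: W1p_norm_def)
      finally have 1: "(\<Sum>x\<in>K. \<bar>?w x\<bar> powr p) \<le> 1" .
      have 2: "(\<Sum>x\<in>K. \<bar>\<phi> N x\<bar> powr p) \<le> mass p (\<phi> N)"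
        unfolding mass_def by (rule sum_le_infsum[OF finite_support_summable[OF fin] _ K]) auto
      have "\<bar>\<phi> n x\<bar> powr p \<le> 2 powr p * (\<bar>?w x\<bar> powr p + \<bar>\<phi> N x\<bar> powr p)" for x
        using abs_diff_powr_le[of p "?w x" "- \<phi> N x"] p_gt_1 by simp
      then have "(\<Sum>x\<in>K. \<bar>\<phi> n x\<bar> powr p) \<le> (\<Sum>x\<in>K. 2 powr p * (\<bar>?w x\<bar> powr p + \<bar>\<phi> N x\<bar> powr p))"
        by (intro sum_mono)
      also have "\<dots> = 2 powr p * ((\<Sum>x\<in>K. \<bar>?w x\<bar> powr p) + (\<Sum>x\<in>K. \<bar>\<phi> N x\<bar> powr p))"
        by (simp add: sum_distrib_left[symmetric] sum.distrib)
      also have "\<dots> \<le> 2 powr p * (1 + mass p (\<phi> N))"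
        using 1 2 by (intro mult_left_mono add_mono) auto
      finally show ?thesis .
    qed
    then show "\<forall>\<^sub>F n in sequentially. (\<Sum>x\<in>K. \<bar>\<phi> n x\<bar> powr p) \<le> 2 powr p * (1 + mass p (\<phi> N))"
      unfolding eventually_sequentially by blast
  qed simp
  show ?thesis using nonneg_infsum_le(1)[OF powr_ge_zero bound] .
qed

text \<open>
  Cut \<open>u\<close> off to finite sets \<open>S n\<close> outside of which every finite partial sum is below \<open>1 / (n + 1)\<close>. Two
  cutoffs differ on the symmetric difference of their sets, which splits into two such outer parts.
\<close>
lemma summable_imp_W1p:
  assumes u: "(\<lambda>x. \<bar>u x\<bar> powr p) summable_on UNIV"
  shows "u \<in> W1p p E"
proof -
  let ?w = "\<lambda>x. \<bar>u x\<bar> powr p"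
  have "\<exists>S. finite S \<and> (\<forall>K. finite K \<longrightarrow> K \<inter> S = {} \<longrightarrow> sum ?w K < 1 / Suc n)" for n
    by (rule summable_tail[OF u, of "1 / Suc n"]) auto
  then obtain S where S: "\<And>n. finite (S n)"
    "\<And>n K. finite K \<Longrightarrow> K \<inter> S n = {} \<Longrightarrow> sum ?w K < 1 / Suc n" by metis
  define \<phi> where "\<phi> n = cutoff (S n) u" for n
  have fin: "finite {x. \<phi> n x \<noteq> 0}" for n
    by (rule finite_subset[OF _ S(1)[of n]]) (auto simp: \<phi>_def cutoff_def)
  have mass_le: "mass p (\<lambda>x. \<phi> m x - \<phi> n x) \<le> 1 / Suc m + 1 / Suc n" for m n
  proof -
    have "mass p (\<lambda>x. \<phi> m x - \<phi> n x) = infsum ?w ((S m - S n) \<union> (S n - S m))"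
      unfolding mass_def by (rule infsum_cong_neutral) (auto simp: \<phi>_def cutoff_def)
    also have "\<dots> = sum ?w (S m - S n) + sum ?w (S n - S m)"
      using S(1) by (subst infsum_finite) (auto intro!: sum.union_disjoint)
    also have "\<dots> \<le> 1 / Suc n + 1 / Suc m"
      using S(1) by (intro add_mono less_imp_le S(2)) auto
    finally show ?thesis by simp
  qed
  have "\<exists>N. \<forall>m\<ge>N. \<forall>n\<ge>N. W1p_norm p E (\<lambda>x. \<phi> m x - \<phi> n x) < \<epsilon>" if e: "\<epsilon> > 0" for \<epsilon>
  proof -
    let ?C = "2 powr p * D + 1"
    have C: "?C > 0" by (simp add: add_nonneg_pos)
    have "\<epsilon> powr p / (2 * ?C) > 0" using e C by simp
    then obtain N where N: "1 / Suc N < \<epsilon> powr p / (2 * ?C)"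
      using reals_Archimedean by (metis inverse_eq_divide)
    have "W1p_norm p E (\<lambda>x. \<phi> m x - \<phi> n x) < \<epsilon>" if mn: "m \<ge> N" "n \<ge> N" for m n
    proof -
      let ?d = "\<lambda>x. \<phi> m x - \<phi> n x"
      have "finite {x. ?d x \<noteq> 0}"
        by (rule finite_subset[OF _ finite_UnI[OF fin[of m] fin[of n]]]) auto
      note ds = finite_support_summable[OF this]
      have "1 / Suc m \<le> 1 / Suc N" "1 / Suc n \<le> 1 / Suc N"
        using mn by (auto simp: frac_le)
      then have "mass p ?d < 2 * (\<epsilon> powr p / (2 * ?C))"
        using mass_le[of m n] N by linarith
      then have "?C * mass p ?d < \<epsilon> powr p"
        using C by (simp add: field_simps)
      then have "W1p_norm p E ?d powr p < \<epsilon> powr p"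
        using W1p_norm_le_mass[OF ds] by linarith
      then show ?thesis
        using p_gt_1 e powr_mono2[of p \<epsilon> "W1p_norm p E ?d"] by (cases "W1p_norm p E ?d < \<epsilon>") auto
    qed
    then show ?thesis by blast
  qed
  moreover have "(\<lambda>n. \<phi> n x) \<longlonglongrightarrow> u x" for x
  proof (cases "u x = 0")
    case True
    then have "\<phi> n x = u x" for n by (simp add: \<phi>_def cutoff_def)
    then show ?thesis by simp
  next
    case False
    then obtain N where N: "1 / Suc N < ?w x"
      using reals_Archimedean[of "?w x"] by (auto simp: inverse_eq_divide)
    have "x \<in> S n" if n: "n \<ge> N" for n
    proof (rule ccontr)
      assume "x \<notin> S n"
      then have "?w x < 1 / Suc n" using S(2)[of "{x}" n] by simp
      also have "\<dots> \<le> 1 / Suc N" using n by (simp add: frac_le)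
      finally show False using N by simp
    qed
    then have "\<forall>\<^sub>F n in sequentially. \<phi> n x = u x"
      unfolding eventually_sequentially by (auto simp: \<phi>_def cutoff_def)
    then show ?thesis by (rule tendsto_eventually)
  qed
  ultimately show ?thesis using fin unfolding W1p_def by blast
qed

text \<open>
  The entropy is positive only where \<open>|u| > 1\<close>, which happens at finitely many vertices.
\<close>
lemma positive_entropy_summable:
  assumes u: "(\<lambda>x. \<bar>u x\<bar> powr p) summable_on UNIV"
  shows "(\<lambda>x. max 0 (\<bar>u x\<bar> powr p * ln (\<bar>u x\<bar> powr p))) summable_on UNIV"
proof -
  let ?w = "\<lambda>x. \<bar>u x\<bar> powr p"
  obtain S where S: "finite S" "\<And>K. finite K \<Longrightarrow> K \<inter> S = {} \<Longrightarrow> sum ?w K < 1"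
    using summable_tail[OF u, of 1] by auto
  have "max 0 (?w x * ln (?w x)) = 0" if "x \<notin> S" for x
    using mult_ln_nonpos[of "?w x"] S(2)[of "{x}"] that by (simp del: ln_powr)
  then have "((\<lambda>x. max 0 (?w x * ln (?w x))) has_sum (\<Sum>x\<in>S. max 0 (?w x * ln (?w x)))) UNIV"
    using S(1) by (intro has_sum_finite_neutralI) auto
  then show ?thesis by (rule has_sum_imp_summable)
qed

lemma kinetic_ext_integral:
  assumes u: "(\<lambda>x. \<bar>u x\<bar> powr p) summable_on UNIV" and V: "\<And>x. \<bar>V x\<bar> \<le> B"
  shows "ext_integral (count_space UNIV) (\<lambda>x. grad_norm p E u x powr p + V x * \<bar>u x\<bar> powr p)
       = ereal (\<Sum>\<^sub>\<infinity>x. grad_norm p E u x powr p + V x * \<bar>u x\<bar> powr p)"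
  by (intro ext_integral_count_space summable_on_add gradient_le_mass[OF u] potential_summable[OF u V])

lemma energy_eq:
  assumes u: "finite_entropy p u" and V: "\<And>x. \<bar>V x\<bar> \<le> B"
  shows "energy p E V u = ereal ((nehari_functional p E V u + mass p u) / p)"
proof -
  have us: "(\<lambda>x. \<bar>u x\<bar> powr p) summable_on UNIV"
    and es: "(\<lambda>x. \<bar>u x\<bar> powr p * ln (\<bar>u x\<bar> powr p)) summable_on UNIV"
    using u by (auto simp: finite_entropy_def)
  have V1: "\<bar>V x + 1\<bar> \<le> B + 1" for x using V[of x] by linarith
  let ?A = "\<lambda>x. grad_norm p E u x powr p + (V x + 1) * \<bar>u x\<bar> powr p"
  have As: "?A summable_on UNIV"
    by (intro summable_on_add gradient_le_mass[OF us] potential_summable[OF us V1])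
  have "infsum ?A UNIV - (\<Sum>\<^sub>\<infinity>x. \<bar>u x\<bar> powr p * ln (\<bar>u x\<bar> powr p))
      = (\<Sum>\<^sub>\<infinity>x. nehari_density p E V u x + \<bar>u x\<bar> powr p)"
    unfolding infsum_diff_real(2)[OF As es, symmetric]
    by (intro infsum_cong) (simp add: nehari_density_def distrib_right del: ln_powr)
  also have "\<dots> = nehari_functional p E V u + mass p u"
    unfolding nehari_functional_def mass_def
    by (intro infsum_add nehari_density_summable[OF u V] us)
  finally show ?thesis
    unfolding energy_def kinetic_ext_integral[OF us V1] ext_integral_count_space[OF es]
    using p_gt_1 by (simp add: diff_divide_distrib[symmetric] del: ln_powr)
qed

lemma energy_domain_iff:
  assumes V: "\<And>x. \<bar>V x\<bar> \<le> B"
  shows "u \<in> energy_domain p E V \<longleftrightarrow> finite_entropy p u"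
proof
  assume "finite_entropy p u"
  then show "u \<in> energy_domain p E V"
    using energy_eq[OF _ V] summable_imp_W1p by (auto simp: energy_domain_def finite_entropy_def)
next
  assume u: "u \<in> energy_domain p E V"
  then have us: "(\<lambda>x. \<bar>u x\<bar> powr p) summable_on UNIV"
    by (auto simp: energy_domain_def W1p_imp_summable)
  have V1: "\<bar>V x + 1\<bar> \<le> B + 1" for x using V[of x] by linarith
  have "ext_integral (count_space UNIV) (\<lambda>x. \<bar>u x\<bar> powr p * ln (\<bar>u x\<bar> powr p)) \<noteq> -\<infinity>"
  proof
    assume "ext_integral (count_space UNIV) (\<lambda>x. \<bar>u x\<bar> powr p * ln (\<bar>u x\<bar> powr p)) = -\<infinity>"
    then have "energy p E V u = \<infinity>"
      unfolding energy_def kinetic_ext_integral[OF us V1] using p_gt_1 by (simp del: ln_powr)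
    with u show False by (simp add: energy_domain_def)
  qed
  with us show "finite_entropy p u"
    unfolding finite_entropy_def
    using ext_integral_not_minf_imp_summable[OF positive_entropy_summable[OF us]] by blast
qed

lemma nehari_iff:
  assumes V: "\<And>x. \<bar>V x\<bar> \<le> B"
  shows "u \<in> nehari p E V \<longleftrightarrow>
    finite_entropy p u \<and> u \<noteq> (\<lambda>_. 0) \<and> nehari_functional p E V u = 0"
proof (cases "finite_entropy p u")
  case True
  then have us: "(\<lambda>x. \<bar>u x\<bar> powr p) summable_on UNIV"
    and es: "(\<lambda>x. \<bar>u x\<bar> powr p * ln (\<bar>u x\<bar> powr p)) summable_on UNIV"
    by (auto simp: finite_entropy_def)
  let ?A = "\<lambda>x. grad_norm p E u x powr p + V x * \<bar>u x\<bar> powr p"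
  have "?A summable_on UNIV"
    by (intro summable_on_add gradient_le_mass[OF us] potential_summable[OF us V])
  from infsum_diff_real(2)[OF this es]
  have "nehari_functional p E V u = infsum ?A UNIV - (\<Sum>\<^sub>\<infinity>x. \<bar>u x\<bar> powr p * ln (\<bar>u x\<bar> powr p))"
    by (simp add: nehari_functional_def nehari_density_def del: ln_powr)
  moreover have "u \<in> nehari p E V \<longleftrightarrow> u \<in> energy_domain p E V \<and> u \<noteq> (\<lambda>_. 0)
      \<and> ereal (infsum ?A UNIV) = ereal (\<Sum>\<^sub>\<infinity>x. \<bar>u x\<bar> powr p * ln (\<bar>u x\<bar> powr p))"
    unfolding nehari_def kinetic_ext_integral[OF us V, symmetric] ext_integral_count_space[OF es, symmetric]
    by blast
  ultimately show ?thesis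
    using True energy_domain_iff[OF V, of u] by simp
next
  case False
  then show ?thesis by (simp add: nehari_def energy_domain_iff[OF V])
qed

lemma mass_pos:
  assumes "(\<lambda>x. \<bar>u x\<bar> powr p) summable_on UNIV" "u \<noteq> (\<lambda>_. 0)"
  shows "mass p u > 0"
proof -
  obtain x where "u x \<noteq> 0" using assms(2) by auto
  then have "0 < \<bar>u x\<bar> powr p" by simp
  also have "\<dots> \<le> mass p u"
    using sum_le_infsum[OF assms(1), of "{x}"] unfolding mass_def by simp
  finally show ?thesis .
qed

text \<open>
  On the Nehari manifold the energy is the mass divided by \<open>p\<close>, and the scaled lower bound with
  \<open>N w = 0\<close> reads \<open>m \<le> ln (mass p w)\<close>.
\<close>
lemma nehari_energy_ge:
  assumes V: "\<And>x. \<bar>V x\<bar> \<le> B"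
    and m: "\<And>u. finite_entropy p u \<Longrightarrow> mass p u = 1 \<Longrightarrow> m \<le> nehari_functional p E V u"
    and w: "w \<in> nehari p E V"
  shows "ereal (exp m / p) \<le> energy p E V w"
proof -
  have w': "finite_entropy p w" "w \<noteq> (\<lambda>_. 0)" "nehari_functional p E V w = 0"
    using w nehari_iff[OF V] by auto
  have pos: "mass p w > 0" using mass_pos w' by (auto simp: finite_entropy_def)
  have "mass p w * (m - ln (mass p w)) \<le> 0"
    using nehari_functional_ge[OF V m w'(1)] w'(3) by (simp add: algebra_simps)
  then have "m \<le> ln (mass p w)" using pos by (simp add: mult_le_0_iff)
  then have "exp m \<le> mass p w" using pos by (metis exp_le_cancel_iff exp_ln)
  then show ?thesis using energy_eq[OF w'(1) V] w'(3) p_gt_1 by (simp add: divide_right_mono)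
qed

text \<open>
  If \<open>v\<close> minimises on the unit sphere with value \<open>m\<close>, then \<open>u = exp (m / p) v\<close> has mass \<open>exp m\<close> and lies on the
  Nehari manifold with the least energy \<open>exp m / p\<close>. The factor turns the Lagrange multiplier \<open>m\<close> in the
  equation of \<open>v\<close> into part of the logarithm.
\<close>
lemma ground_state_exists:
  assumes conn: "graph_connected E"
    and aut: "\<And>g. g \<in> G \<Longrightarrow> bij g" "\<And>g x y. g \<in> G \<Longrightarrow> (g x, g y) \<in> E \<longleftrightarrow> (x, y) \<in> E"
    and Z: "finite Z" "\<And>x. \<exists>z\<in>Z. \<exists>g\<in>G. g z = x"
    and V: "\<And>x. V x \<ge> -1" "\<And>x. \<bar>V x\<bar> \<le> B"
    and Vp: "\<And>g x. g \<in> G \<Longrightarrow> Vp (g x) = Vp x" "\<And>x. V x \<le> Vp x" "\<And>x. \<bar>Vp x\<bar> \<le> B"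
    and inf: "((\<lambda>x. \<bar>V x - Vp x\<bar>) \<longlongrightarrow> 0) (at_graph_infinity E x0)"
  shows "\<exists>u. is_ground_state p E V u \<and> (\<forall>x. u x > 0)"
proof -
  have "\<exists>v. finite_entropy p v \<and> mass p v = 1 \<and> (\<forall>x. v x \<ge> 0) \<and>
    (\<forall>u. finite_entropy p u \<longrightarrow> mass p u = 1 \<longrightarrow>
       nehari_functional p E V v \<le> nehari_functional p E V u)"
    by (rule minimizer_exists[of G Z V B Vp x0]) (fact conn aut Z V Vp inf)+
  then obtain v where v: "finite_entropy p v" "mass p v = 1" "\<And>x. v x \<ge> 0"
    and min: "\<And>u. finite_entropy p u \<Longrightarrow> mass p u = 1 \<Longrightarrow>
       nehari_functional p E V v \<le> nehari_functional p E V u"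
    by blast
  define m where "m = nehari_functional p E V v"
  note EL = euler_lagrange[OF v(1,2) V(2) min, folded m_def]
  have v0: "v \<noteq> (\<lambda>_. 0)" using v(2) by (auto simp: mass_def)
  have v_pos: "v x > 0" for x
  proof (rule strong_maximum_principle[OF conn v(3) v0])
    show "p_Laplacian p E v y = 0" if "v y = 0" for y
      using EL[of y] that by simp
  qed
  define c where "c = exp (m / p)"
  have c: "c > 0" "c powr p = exp m"
    using p_gt_1 by (auto simp: c_def powr_def)
  define u where "u x = c * v x" for x
  note sc = nehari_functional_scale[OF v(1) V(2) c(1), folded u_def]
  have N: "nehari_functional p E V u = 0" and M: "mass p u = exp m"
    using sc v(2) by (auto simp: c(2) simp flip: m_def)
  have u_pos: "u x > 0" for x using v_pos c by (simp add: u_def)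
  have u0: "u \<noteq> (\<lambda>_. 0)" using u_pos[of x0] by auto
  have dom: "u \<in> energy_domain p E V" and neh: "u \<in> nehari p E V"
    using sc(1) u0 N energy_domain_iff[OF V(2)] nehari_iff[OF V(2)] by auto
  have J: "energy p E V u = ereal (exp m / p)"
    unfolding energy_eq[OF sc(1) V(2)] N M by simp
  have sol: "- p_Laplacian p E u x + V x * \<bar>u x\<bar> powr (p - 2) * u x
          = \<bar>u x\<bar> powr (p - 2) * u x * ln (\<bar>u x\<bar> powr p)" for x
  proof -
    let ?k = "c powr (p - 2) * c"
    have ph: "\<bar>c * t\<bar> powr (p - 2) * (c * t) = ?k * (\<bar>t\<bar> powr (p - 2) * t)" for t
      using c(1) by (simp add: abs_mult powr_mult)
    have L: "p_Laplacian p E u x = ?k * p_Laplacian p E v x"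
      unfolding p_Laplacian_def u_def right_diff_distrib[symmetric] ph sum_distrib_left ..
    have "\<bar>u x\<bar> powr p = exp m * \<bar>v x\<bar> powr p"
      using c by (simp add: u_def abs_mult powr_mult)
    then have l: "ln (\<bar>u x\<bar> powr p) = ln (\<bar>v x\<bar> powr p) + m"
      using v_pos[of x] by (simp add: ln_mult del: ln_powr)
    have f: "\<bar>u x\<bar> powr (p - 2) * u x = ?k * (\<bar>v x\<bar> powr (p - 2) * v x)"
      unfolding u_def ph ..
    have lin: "- (k * a) + b * (k * d) = k * d * e" if "- a + b * d = d * e" for k a b d e :: real
    proof -
      have "- (k * a) + b * (k * d) = k * (- a + b * d)" by (simp add: algebra_simps)
      then show ?thesis unfolding that by (simp add: mult.assoc)
    qed
    show ?thesis
      unfolding mult.assoc[of "V x"] f L l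
      by (rule lin) (use EL[of x] in \<open>simp only: mult.assoc[of "V x"]\<close>)
  qed
  have "energy p E V u = (INF w\<in>nehari p E V. energy p E V w)"
  proof (rule antisym)
    show "energy p E V u \<le> (INF w\<in>nehari p E V. energy p E V w)"
      unfolding J using nehari_energy_ge[OF V(2) min] by (intro INF_greatest) (auto simp: m_def)
  qed (rule INF_lower[OF neh])
  then have "is_ground_state p E V u"
    using dom sol u0 unfolding is_ground_state_def is_solution_def by blast
  with u_pos show ?thesis by blast
qed

end

section \<open>Ground states\<close>

theorem theorem6p7:
  fixes p :: real
    and E :: "('v \<times> 'v) set"
    and \<Gamma> :: "('v \<Rightarrow> 'v) set"
    and V :: "'v \<Rightarrow> real"
    and x0 :: 'v
  assumes "p > 1"
    and "sym E"
    and "graph_connected E"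
    and "locally_finite_graph E"
    and "quasi_transitive E"
    and "subgroup \<Gamma> (graph_Aut E)"
    and "finitely_many_orbits E \<Gamma>"
    and "(INF x. ereal (V x)) > -1"
    and "invariant_under \<Gamma> V
       \<or> (\<exists>Vp. invariant_under \<Gamma> Vp \<and> (\<forall>x. V x \<le> Vp x)
              \<and> ((\<lambda>x. \<bar>V x - Vp x\<bar>) \<longlongrightarrow> 0) (at_graph_infinity E x0))
       \<or> (\<exists>Vinf :: real. (SUP x. ereal (V x)) = ereal Vinf
              \<and> (V \<longlongrightarrow> Vinf) (at_graph_infinity E x0))"
  shows "\<exists>u. is_ground_state p E V u \<and> ((\<forall>x. u x > 0) \<or> (\<forall>x. u x < 0))"
proof -
  \<comment> \<open>All three alternatives provide an invariant potential above \<open>V\<close> and asymptotic to it: \<open>V\<close> itself,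
    the given \<open>Vp\<close>, or the constant \<open>Vinf\<close>.\<close>
  obtain Vp where inv: "invariant_under \<Gamma> Vp" and le: "\<And>x. V x \<le> Vp x"
    and lim: "((\<lambda>x. \<bar>V x - Vp x\<bar>) \<longlongrightarrow> 0) (at_graph_infinity E x0)"
  proof -
    consider "invariant_under \<Gamma> V"
      | Vp where "invariant_under \<Gamma> Vp" "\<And>x. V x \<le> Vp x"
          "((\<lambda>x. \<bar>V x - Vp x\<bar>) \<longlongrightarrow> 0) (at_graph_infinity E x0)"
      | Vinf :: real where "(SUP x. ereal (V x)) = ereal Vinf" "(V \<longlongrightarrow> Vinf) (at_graph_infinity E x0)"
      using assms(9) by blast
    then show thesis
    proof cases
      case 1
      then show thesis by (intro that[of V]) auto
    next
      case 2
      then show thesis by (rule that)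
    next
      case 3
      have "ereal (V x) \<le> ereal Vinf" for x
        unfolding 3(1)[symmetric] by (rule SUP_upper) simp
      moreover have "((\<lambda>x. \<bar>V x - Vinf\<bar>) \<longlongrightarrow> 0) (at_graph_infinity E x0)"
        using 3(2) by (simp add: tendsto_rabs_zero_iff LIM_zero_iff)
      ultimately show thesis
        by (intro that[of "\<lambda>_. Vinf"]) (auto simp: invariant_under_def)
    qed
  qed
  obtain Z where Z: "finite Z" "\<And>x. \<exists>z\<in>Z. \<exists>g\<in>\<Gamma>. g z = x"
    using finitely_many_orbits_representatives[OF assms(6,7)] by blast
  note aut = subgroup_graph_Aut[OF assms(6)]
  \<comment> \<open>Degrees and \<open>Vp\<close> are constant on orbits, hence bounded.\<close>
  define D where "D = Max ((\<lambda>x. card (E `` {x})) ` Z)"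
  have D: "card (E `` {x}) \<le> D" for x
  proof -
    obtain z g where zg: "z \<in> Z" "g \<in> \<Gamma>" "g z = x" using Z(2) by blast
    then have "card (E `` {x}) = card (E `` {z})"
      using card_neighbours_automorphism[OF aut, OF zg(2) zg(2)] by blast
    also have "\<dots> \<le> D" unfolding D_def using Z(1) zg(1) by (intro Max_ge) auto
    finally show ?thesis .
  qed
  define B where "B = max 1 (Max (Vp ` Z))"
  have Vp_le: "Vp x \<le> B" for x
  proof -
    obtain z g where zg: "z \<in> Z" "g \<in> \<Gamma>" "g z = x" using Z(2) by blast
    then have "Vp x = Vp z" using inv by (auto simp: invariant_under_def)
    also have "\<dots> \<le> Max (Vp ` Z)" using Z(1) zg(1) by (intro Max_ge) auto
    finally show ?thesis by (simp add: B_def)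
  qed
  have V_ge: "V x > -1" for x
  proof -
    have "-1 < ereal (V x)" using assms(8) INF_lower[of x UNIV "\<lambda>x. ereal (V x)"]
      by (simp add: less_le_trans)
    then show ?thesis by (metis ereal_less(2) less_ereal.simps(1) one_ereal_def uminus_ereal.simps(1))
  qed
  have B: "B \<ge> 1" by (simp add: B_def)
  have bounds: "\<bar>V x\<bar> \<le> B" "\<bar>Vp x\<bar> \<le> B" for x
    using V_ge[of x] le[of x] Vp_le[of x] B by auto
  interpret bounded_degree_graph p E D
    using assms(1,2,4) D by unfold_locales (auto simp: locally_finite_graph_def)
  have inv': "Vp (g x) = Vp x" if "g \<in> \<Gamma>" for g x
    using inv that by (simp add: invariant_under_def)
  have "\<exists>u. is_ground_state p E V u \<and> (\<forall>x. u x > 0)"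
    by (rule ground_state_exists[of \<Gamma> Z V B Vp x0])
      (fact assms(3) aut Z less_imp_le[OF V_ge] bounds inv' le lim)+
  then show ?thesis by blast
qed

end
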